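(* Let $H$ be a Hopf algebra and $\delta$ a character on $H$ with $S_\delta^2=\mathrm{Id}$. Then for any $H$-algebra $R$, the operators $d,b,k,B$ acting on the non-commutative differential forms $\Omega^*(R)$ descend to the localization $\Omega^*(R)_\delta$.
   Context: $H$ is a Hopf algebra over $\mathbb{C}$ with counit $\epsilon$, antipode $S$, coproduct $\Delta(h)=\sum h_0\otimes h_1$; a character is a non-zero algebra map $\delta:H\to\mathbb{C}$; $S_\delta(h)=\sum\delta(h_0)S(h_1)$. For an $H$-module $V$, $V_\delta=V/\mathrm{span}\{hv-\delta(h)v:h\in H,v\in V\}$. An $H$-algebra is a (not necessarily unital) algebra $R$ with an action of the algebra $H$ which is flat: $h(ab)=\sum h_0(a)h_1(b)$. $\tilde R$ is $R$ with a unit adjoined, with $h\cdot1=\epsilon(h)1$. $\Omega^0(R)=R$ and $\Omega^n(R)=\tilde R\otimes R^{\otimes n}$ for $n\ge1$, with elements written $a_0\,da_1\cdots da_n$; $\Omega^*(R)$ is a graded algebra with $(da)b=d(ab)-a\,db$, and $H$ acts on it diagonally. The operators are: $d(a_0da_1\cdots da_n)=da_0da_1\cdots da_n$ (with $d1=0$); $b(\omega\,da)=(-1)^{\deg\omega}[\omega,a]=(-1)^{\deg\omega}(\omega a-a\omega)$, and $b=0$ on $\Omega^0(R)$; $k=1-(bd+db)$; $B=(1+k+\cdots+k^n)d$ on $\Omega^n(R)$. *)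

theory Defs
  imports Complex_Main "HOL-Library.Poly_Mapping" "HOL-Library.Set_Algebras"
begin

section \<open>Complex vector spaces and algebras\<close>

class complex_vector = ab_group_add +
  fixes scaleC :: "complex \<Rightarrow> 'a \<Rightarrow> 'a"  (infixr "*\<^sub>C" 75)
  assumes scaleC_add_right: "c *\<^sub>C (x + y) = c *\<^sub>C x + c *\<^sub>C y"
    and scaleC_add_left: "(c + d) *\<^sub>C x = c *\<^sub>C x + d *\<^sub>C x"
    and scaleC_scaleC: "c *\<^sub>C (d *\<^sub>C x) = (c * d) *\<^sub>C x"
    and scaleC_one: "1 *\<^sub>C x = x"

global_interpretation complex_vector: vector_space "scaleC :: complex \<Rightarrow> 'a \<Rightarrow> 'a::complex_vector"
  by unfold_locales (simp_all add: scaleC_add_right scaleC_add_left scaleC_scaleC scaleC_one)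

text \<open>Algebras are associative but need not be unital; the zero algebra is allowed.\<close>

class complex_algebra = complex_vector + ring +
  assumes mult_scaleC_left: "(c *\<^sub>C x) * y = c *\<^sub>C (x * y)"
    and mult_scaleC_right: "x * (c *\<^sub>C y) = c *\<^sub>C (x * y)"

class complex_algebra_1 = complex_algebra + ring_1

instantiation complex :: complex_algebra_1
begin
definition scaleC_complex :: "complex \<Rightarrow> complex \<Rightarrow> complex"
  where "scaleC_complex c x = c * x"
instance
  by standard (simp_all add: scaleC_complex_def algebra_simps)
end

abbreviation clinear :: "('a::complex_vector \<Rightarrow> 'b::complex_vector) \<Rightarrow> bool"
  where "clinear \<equiv> Vector_Spaces.linear scaleC scaleC"

definition cbilinear :: "('a::complex_vector \<Rightarrow> 'b::complex_vector \<Rightarrow> 'c::complex_vector) \<Rightarrow> bool"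
  where "cbilinear f \<longleftrightarrow> (\<forall>x. clinear (f x)) \<and> (\<forall>y. clinear (\<lambda>x. f x y))"

lemma clinear_iff:
  "clinear f \<longleftrightarrow> (\<forall>x y. f (x + y) = f x + f y) \<and> (\<forall>c x. f (c *\<^sub>C x) = c *\<^sub>C f x)"
  by (simp add: Vector_Spaces.linear_iff complex_vector.vector_space_axioms)

lemma clinearI:
  assumes "\<And>x y. f (x + y) = f x + f y" "\<And>c x. f (c *\<^sub>C x) = c *\<^sub>C f x"
  shows "clinear f"
  using assms by (simp add: clinear_iff)

lemma clinear_add: "clinear f \<Longrightarrow> f (x + y) = f x + f y"
  and clinear_scale: "clinear f \<Longrightarrow> f (c *\<^sub>C x) = c *\<^sub>C f x"
  by (simp_all add: clinear_iff)

lemma clinear_0: assumes "clinear f" shows "f 0 = 0"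
  using clinear_scale[OF assms, of 0 0] by simp

lemma clinear_diff: assumes "clinear f" shows "f (x - y) = f x - f y"
  using clinear_add[OF assms, of "x - y" y] by simp

lemma clinear_compose: "clinear f \<Longrightarrow> clinear g \<Longrightarrow> clinear (\<lambda>x. f (g x))"
  by (simp add: clinear_iff)

lemma clinear_plus: "clinear f \<Longrightarrow> clinear g \<Longrightarrow> clinear (\<lambda>x. f x + g x)"
  by (simp add: clinear_iff scaleC_add_right)

lemma clinear_minus: "clinear f \<Longrightarrow> clinear g \<Longrightarrow> clinear (\<lambda>x. f x - g x)"
  by (simp add: clinear_iff complex_vector.scale_right_diff_distrib)

lemma clinear_uminus: "clinear f \<Longrightarrow> clinear (\<lambda>x. - f x)"
  by (simp add: clinear_iff)

lemma clinear_zero: "clinear (\<lambda>x. 0)"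
  by (simp add: clinear_iff)

lemma clinear_id: "clinear (\<lambda>x. x)"
  by (simp add: clinear_iff)

lemma clinear_scaleC: "clinear (\<lambda>x. c *\<^sub>C x)"
  by (simp add: clinear_iff scaleC_add_right scaleC_scaleC mult.commute)

lemma clinear_sum: "(\<And>i. i \<in> I \<Longrightarrow> clinear (f i)) \<Longrightarrow> clinear (\<lambda>x. \<Sum>i\<in>I. f i x)"
  by (induction I rule: infinite_finite_induct) (auto intro: clinear_zero clinear_plus)

lemma clinear_linear_combination:
  "clinear h \<Longrightarrow> h (\<Sum>x\<in>A. c x *\<^sub>C q x) = (\<Sum>x\<in>A. c x *\<^sub>C h (q x))"
  by (induction A rule: infinite_finite_induct) (simp_all add: clinear_0 clinear_add clinear_scale)

lemma clinearI_combination: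
  assumes "\<And>c x y. f (c *\<^sub>C x + y) = c *\<^sub>C f x + f y"
  shows "clinear f"
proof -
  have "f 0 = 0" using assms[of 1 0 0] by (simp add: scaleC_one)
  then show ?thesis using assms[of 1] assms[of _ _ 0]
    by (intro clinearI) (simp_all add: scaleC_one)
qed

lemma cbilinearI:
  assumes "\<And>x. clinear (f x)" "\<And>y. clinear (\<lambda>x. f x y)"
  shows "cbilinear f"
  using assms by (simp add: cbilinear_def)

lemma cbilinear_right: "cbilinear f \<Longrightarrow> clinear (f x)"
  and cbilinear_left: "cbilinear f \<Longrightarrow> clinear (\<lambda>x. f x y)"
  by (simp_all add: cbilinear_def)

section \<open>Free vector spaces\<close>

instantiation poly_mapping :: (type, complex_vector) complex_vector
begin
lift_definition scaleC_poly_mapping :: "complex \<Rightarrow> ('a \<Rightarrow>\<^sub>0 'b) \<Rightarrow> ('a \<Rightarrow>\<^sub>0 'b)"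
  is "\<lambda>c f x. c *\<^sub>C f x"
  by (rule finite_subset[of _ "{x. _ x \<noteq> 0}"]) auto
instance
  by standard
    (transfer; simp add: fun_eq_iff scaleC_add_right scaleC_add_left scaleC_scaleC scaleC_one)+
end

lemma lookup_scaleC: "Poly_Mapping.lookup (c *\<^sub>C p) x = c *\<^sub>C Poly_Mapping.lookup p x"
  by transfer simp

definition free_lift :: "('x \<Rightarrow> 'v::complex_vector) \<Rightarrow> ('x \<Rightarrow>\<^sub>0 complex) \<Rightarrow> 'v"
  where "free_lift f p = (\<Sum>x\<in>Poly_Mapping.keys p. Poly_Mapping.lookup p x *\<^sub>C f x)"

lemma free_lift_superset:
  assumes "finite A" "Poly_Mapping.keys p \<subseteq> A"
  shows "free_lift f p = (\<Sum>x\<in>A. Poly_Mapping.lookup p x *\<^sub>C f x)"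
  unfolding free_lift_def
  by (rule sum.mono_neutral_left) (use assms in \<open>auto simp: in_keys_iff\<close>)

lemma clinear_free_lift: "clinear (free_lift f)"
proof (rule clinearI)
  fix p q :: "'a \<Rightarrow>\<^sub>0 complex"
  let ?A = "Poly_Mapping.keys p \<union> Poly_Mapping.keys q"
  have "Poly_Mapping.keys (p + q) \<subseteq> ?A" by (rule keys_add)
  then show "free_lift f (p + q) = free_lift f p + free_lift f q"
    by (simp add: free_lift_superset[of ?A] lookup_add scaleC_add_left sum.distrib)
next
  fix c and p :: "'a \<Rightarrow>\<^sub>0 complex"
  have "Poly_Mapping.keys (c *\<^sub>C p) \<subseteq> Poly_Mapping.keys p"
    by (auto simp: in_keys_iff lookup_scaleC)
  then show "free_lift f (c *\<^sub>C p) = c *\<^sub>C free_lift f p"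
    by (simp add: free_lift_superset[of "Poly_Mapping.keys p"] lookup_scaleC
        scaleC_complex_def complex_vector.scale_sum_right scaleC_scaleC)
qed

lemma free_lift_single [simp]: "free_lift f (Poly_Mapping.single x c) = c *\<^sub>C f x"
  by (simp add: free_lift_def)

lemma free_lift_span:
  assumes "\<And>r. r \<in> R \<Longrightarrow> free_lift f r = 0" "p \<in> complex_vector.span R"
  shows "free_lift f p = 0"
  using assms(2)
proof (induction rule: complex_vector.span_induct_alt)
  case base show ?case by (rule clinear_0[OF clinear_free_lift])
next
  case (step c x y)
  then show ?case
    by (simp add: clinear_add[OF clinear_free_lift] clinear_scale[OF clinear_free_lift] assms(1))
qed

lemma free_lift_generate:
  "p = free_lift (\<lambda>x. Poly_Mapping.single x 1) p"
proof (rule poly_mapping_eqI)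
  fix k
  have "Poly_Mapping.lookup (free_lift (\<lambda>x. Poly_Mapping.single x 1) p) k
      = (\<Sum>x\<in>Poly_Mapping.keys p. if x = k then Poly_Mapping.lookup p x else 0)"
    unfolding free_lift_def lookup_sum
    by (rule sum.cong) (auto simp: lookup_scaleC scaleC_complex_def lookup_single when_def)
  also have "\<dots> = Poly_Mapping.lookup p k"
    by (simp add: sum.delta in_keys_iff)
  finally show "Poly_Mapping.lookup p k
      = Poly_Mapping.lookup (free_lift (\<lambda>x. Poly_Mapping.single x 1) p) k" ..
qed

section \<open>Tensor product of two vector spaces\<close>

definition tensor_relations :: "('a::complex_vector \<times> 'b::complex_vector \<Rightarrow>\<^sub>0 complex) set"
  where "tensor_relations =
    {Poly_Mapping.single (c *\<^sub>C x + y, z) 1 - c *\<^sub>C Poly_Mapping.single (x, z) 1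
      - Poly_Mapping.single (y, z) 1 | c x y z. True} \<union>
    {Poly_Mapping.single (z, c *\<^sub>C x + y) 1 - c *\<^sub>C Poly_Mapping.single (z, x) 1
      - Poly_Mapping.single (z, y) 1 | c x y z. True}"

definition tensor_rel ::
  "('a::complex_vector \<times> 'b::complex_vector \<Rightarrow>\<^sub>0 complex) \<Rightarrow> ('a \<times> 'b \<Rightarrow>\<^sub>0 complex) \<Rightarrow> bool"
  where "tensor_rel p q \<longleftrightarrow> p - q \<in> complex_vector.span tensor_relations"

lemma span_rel_equivp: "equivp (\<lambda>p q. p - q \<in> complex_vector.span R)"
proof (rule equivpI)
  show "reflp (\<lambda>p q. p - q \<in> complex_vector.span R)"
    by (simp add: reflp_def complex_vector.span_zero)
  show "symp (\<lambda>p q. p - q \<in> complex_vector.span R)"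
    by (rule sympI) (metis complex_vector.span_neg minus_diff_eq)
  show "transp (\<lambda>p q. p - q \<in> complex_vector.span R)"
    by (rule transpI) (metis complex_vector.span_add diff_add_cancel add_diff_eq)
qed

quotient_type (overloaded) ('a, 'b) tensor =
  "('a::complex_vector \<times> 'b::complex_vector) \<Rightarrow>\<^sub>0 complex" / tensor_rel
  unfolding tensor_rel_def[abs_def] by (rule span_rel_equivp)

lemma span_rel_add:
  assumes "p - p' \<in> complex_vector.span R" "q - q' \<in> complex_vector.span R"
  shows "(p + q) - (p' + q') \<in> complex_vector.span R"
  using complex_vector.span_add[OF assms] by (simp add: algebra_simps)

lemma span_rel_diff:
  assumes "p - p' \<in> complex_vector.span R" "q - q' \<in> complex_vector.span R"
  shows "(p - q) - (p' - q') \<in> complex_vector.span R"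
  using complex_vector.span_diff[OF assms] by (simp add: algebra_simps)

lemma span_rel_uminus:
  assumes "p - p' \<in> complex_vector.span R"
  shows "- p - (- p') \<in> complex_vector.span R"
  using complex_vector.span_neg[OF assms] by (simp add: algebra_simps)

lemma span_rel_scaleC:
  assumes "p - p' \<in> complex_vector.span R"
  shows "c *\<^sub>C p - c *\<^sub>C p' \<in> complex_vector.span R"
  using complex_vector.span_scale[OF assms, of c]
  by (simp add: complex_vector.scale_right_diff_distrib)

instantiation tensor :: (complex_vector, complex_vector) complex_vector
begin
lift_definition zero_tensor :: "('a, 'b) tensor" is 0 .
lift_definition plus_tensor :: "('a, 'b) tensor \<Rightarrow> ('a, 'b) tensor \<Rightarrow> ('a, 'b) tensor"
  is "(+)" unfolding tensor_rel_def by (rule span_rel_add)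
lift_definition minus_tensor :: "('a, 'b) tensor \<Rightarrow> ('a, 'b) tensor \<Rightarrow> ('a, 'b) tensor"
  is "(-)" unfolding tensor_rel_def by (rule span_rel_diff)
lift_definition uminus_tensor :: "('a, 'b) tensor \<Rightarrow> ('a, 'b) tensor"
  is uminus unfolding tensor_rel_def by (rule span_rel_uminus)
lift_definition scaleC_tensor :: "complex \<Rightarrow> ('a, 'b) tensor \<Rightarrow> ('a, 'b) tensor"
  is "(*\<^sub>C)" unfolding tensor_rel_def by (rule span_rel_scaleC)
instance
  by standard
    (transfer; simp add: tensor_rel_def complex_vector.span_zero add_ac scaleC_add_right
      scaleC_add_left scaleC_scaleC scaleC_one)+
end

lift_definition tensor_of :: "'a::complex_vector \<Rightarrow> 'b::complex_vector \<Rightarrow> ('a, 'b) tensor"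
    (infixr "\<otimes>" 72)
  is "\<lambda>x y. Poly_Mapping.single (x, y) 1" .

text \<open>The linear map on the tensor product induced by a bilinear map (meaningful only for
  bilinear arguments); \<open>tensor_lift f t\<close> is \<open>\<Sum> f x\<^sub>0 x\<^sub>1\<close> when \<open>t = \<Sum> x\<^sub>0 \<otimes> x\<^sub>1\<close>, so that Sweedler
  sums read \<open>tensor_lift (\<lambda>h0 h1. \<dots>) (\<Delta> h)\<close>.\<close>

definition tensor_lift ::
  "('a::complex_vector \<Rightarrow> 'b::complex_vector \<Rightarrow> 'c::complex_vector) \<Rightarrow> ('a, 'b) tensor \<Rightarrow> 'c"
  where "tensor_lift f t = free_lift (case_prod f) (rep_tensor t)"

lemma tensor_lift_abs:
  assumes "cbilinear f"
  shows "tensor_lift f (abs_tensor p) = free_lift (case_prod f) p"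
proof -
  have "tensor_rel (rep_tensor (abs_tensor p)) p"
    by (rule Quotient3_rep_abs[OF Quotient3_tensor]) (simp add: tensor_rel_def complex_vector.span_zero)
  then have "free_lift (case_prod f) (rep_tensor (abs_tensor p) - p) = 0"
    unfolding tensor_rel_def
    by (rule free_lift_span[rotated])
      (use assms in \<open>auto simp: tensor_relations_def cbilinear_def clinear_iff scaleC_one
        clinear_diff[OF clinear_free_lift] clinear_scale[OF clinear_free_lift]\<close>)
  then show ?thesis
    by (simp add: tensor_lift_def clinear_diff[OF clinear_free_lift])
qed

lemma tensor_lift_of [simp]: "cbilinear f \<Longrightarrow> tensor_lift f (x \<otimes> y) = f x y"
  unfolding tensor_of.abs_eq by (simp add: tensor_lift_abs scaleC_one)

lemma clinear_tensor_lift: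
  assumes "cbilinear f" shows "clinear (tensor_lift f)"
proof (rule clinearI)
  fix s t :: "('a, 'b) tensor" and c
  obtain p q where [simp]: "s = abs_tensor p" "t = abs_tensor q"
    by (metis Quotient3_abs_rep[OF Quotient3_tensor])
  show "tensor_lift f (s + t) = tensor_lift f s + tensor_lift f t"
    by (simp add: plus_tensor.abs_eq tensor_lift_abs[OF assms] clinear_add[OF clinear_free_lift])
  show "tensor_lift f (c *\<^sub>C s) = c *\<^sub>C tensor_lift f s"
    by (simp add: scaleC_tensor.abs_eq tensor_lift_abs[OF assms] clinear_scale[OF clinear_free_lift])
qed

lemma cbilinear_tensor_of: "cbilinear (\<otimes>)"
proof (intro cbilinearI)
  have ab: "abs_tensor p = abs_tensor q" if "p - q \<in> tensor_relations"
    for p q :: "('a \<times> 'b) \<Rightarrow>\<^sub>0 complex"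
    using that complex_vector.span_base
    by (simp add: tensor.abs_eq_iff tensor_rel_def)
  have *: "(c *\<^sub>C x + y) \<otimes> z = c *\<^sub>C (x \<otimes> z) + y \<otimes> z" for c and x y :: 'a and z :: 'b
    unfolding tensor_of.abs_eq scaleC_tensor.abs_eq plus_tensor.abs_eq
    by (rule ab) (unfold tensor_relations_def diff_diff_eq, blast)
  have **: "z \<otimes> (c *\<^sub>C x + y) = c *\<^sub>C (z \<otimes> x) + z \<otimes> y" for c and z :: 'a and x y :: 'b
    unfolding tensor_of.abs_eq scaleC_tensor.abs_eq plus_tensor.abs_eq
    by (rule ab) (unfold tensor_relations_def diff_diff_eq, blast)
  show "clinear ((\<otimes>) x :: 'b \<Rightarrow> _)" for x :: 'a by (rule clinearI_combination) (rule **)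
  show "clinear (\<lambda>x :: 'a. x \<otimes> y)" for y :: 'b by (rule clinearI_combination) (rule *)
qed

lemma tensor_eqI:
  assumes "clinear f" "clinear g" "\<And>x y. f (x \<otimes> y) = g (x \<otimes> y)"
  shows "f t = g t"
proof -
  obtain p where t: "t = abs_tensor p"
    by (metis Quotient3_abs_rep[OF Quotient3_tensor])
  have abs: "clinear (abs_tensor :: _ \<Rightarrow> ('a, 'b) tensor)"
    by (rule clinearI) (simp_all add: plus_tensor.abs_eq scaleC_tensor.abs_eq)
  have "t = (\<Sum>(x, y)\<in>Poly_Mapping.keys p. Poly_Mapping.lookup p (x, y) *\<^sub>C (x \<otimes> y))"
    unfolding t by (subst free_lift_generate)
      (simp add: free_lift_def clinear_linear_combination[OF abs] tensor_of.abs_eq case_prod_beta)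
  then show ?thesis
    by (simp add: case_prod_beta clinear_linear_combination[OF assms(1)]
        clinear_linear_combination[OF assms(2)] assms(3))
qed

lemma clinear_tensor_lift_param:
  assumes "\<And>a b. clinear (\<lambda>x. g x a b)"
  shows "clinear (\<lambda>x. tensor_lift (g x) t)"
  unfolding tensor_lift_def free_lift_def case_prod_beta
  by (intro clinear_sum clinear_compose[OF clinear_scaleC] assms)

definition tensor_map ::
  "('a::complex_vector \<Rightarrow> 'c::complex_vector) \<Rightarrow> ('b::complex_vector \<Rightarrow> 'd::complex_vector)
    \<Rightarrow> ('a, 'b) tensor \<Rightarrow> ('c, 'd) tensor"
  where "tensor_map f g = tensor_lift (\<lambda>x y. f x \<otimes> g y)"

definition tensor_assoc ::
  "(('a::complex_vector, 'b::complex_vector) tensor, 'c::complex_vector) tensor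
    \<Rightarrow> ('a, ('b, 'c) tensor) tensor"
  where "tensor_assoc = tensor_lift (\<lambda>t z. tensor_lift (\<lambda>x y. x \<otimes> (y \<otimes> z)) t)"

definition tensor_mult ::
  "('a::complex_algebra, 'b::complex_algebra) tensor \<Rightarrow> ('a, 'b) tensor \<Rightarrow> ('a, 'b) tensor"
  where "tensor_mult s t = tensor_lift (\<lambda>a b. tensor_lift (\<lambda>c d. (a * c) \<otimes> (b * d)) t) s"

lemma clinear_tensor_of:
  "clinear f \<Longrightarrow> clinear (\<lambda>x. y \<otimes> f x)" "clinear f \<Longrightarrow> clinear (\<lambda>x. f x \<otimes> z)"
  using clinear_compose[OF cbilinear_right[OF cbilinear_tensor_of]]
    clinear_compose[OF cbilinear_left[OF cbilinear_tensor_of]] by blast+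

lemma tensor_map_of:
  assumes "clinear f" "clinear g"
  shows "tensor_map f g (x \<otimes> y) = f x \<otimes> g y"
  unfolding tensor_map_def
  by (rule tensor_lift_of) (intro cbilinearI clinear_tensor_of assms)

lemma tensor_assoc_of: "tensor_assoc ((x \<otimes> y) \<otimes> z) = x \<otimes> (y \<otimes> z)"
proof -
  have 1: "cbilinear (\<lambda>x y. x \<otimes> (y \<otimes> z))" for z
    by (intro cbilinearI clinear_tensor_of clinear_id)
  have 2: "cbilinear (\<lambda>t z. tensor_lift (\<lambda>x y. x \<otimes> (y \<otimes> z)) t)"
    by (intro cbilinearI clinear_tensor_lift_param clinear_tensor_lift 1 clinear_tensor_of clinear_id)
  show ?thesis
    by (simp add: tensor_assoc_def tensor_lift_of[OF 1] tensor_lift_of[OF 2])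
qed

lemma tensor_mult_of: "tensor_mult (a \<otimes> b) (c \<otimes> d) = (a * c) \<otimes> (b * d)"
proof -
  have lin: "clinear (\<lambda>x. x * y)" "clinear (\<lambda>x. y * x)" for y :: "'z::complex_algebra"
    by (simp_all add: clinear_iff algebra_simps mult_scaleC_left mult_scaleC_right)
  have 1: "cbilinear (\<lambda>c d. (a * c) \<otimes> (b * d))" for a :: 'a and b :: 'b
    by (intro cbilinearI clinear_tensor_of lin)
  have 2: "cbilinear (\<lambda>a b. tensor_lift (\<lambda>c d. (a * c) \<otimes> (b * d)) t)" for t :: "('a, 'b) tensor"
    by (intro cbilinearI clinear_tensor_lift_param clinear_tensor_of lin)
  show ?thesis
    unfolding tensor_mult_def by (subst tensor_lift_of[OF 2]) (rule tensor_lift_of[OF 1])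
qed

section \<open>Hopf algebras, modules and algebras over them\<close>

locale hopf_algebra =
  fixes \<Delta> :: "'h::complex_algebra_1 \<Rightarrow> ('h, 'h) tensor"
    and \<epsilon> :: "'h \<Rightarrow> complex"
    and S :: "'h \<Rightarrow> 'h"
  assumes comult_linear: "clinear \<Delta>"
    and counit_linear: "clinear \<epsilon>"
    and antipode_linear: "clinear S"
    and coassoc: "tensor_assoc (tensor_map \<Delta> id (\<Delta> h)) = tensor_map id \<Delta> (\<Delta> h)"
    and counit_left: "tensor_lift (\<lambda>h0 h1. \<epsilon> h0 *\<^sub>C h1) (\<Delta> h) = h"
    and counit_right: "tensor_lift (\<lambda>h0 h1. \<epsilon> h1 *\<^sub>C h0) (\<Delta> h) = h"
    and comult_mult: "\<Delta> (g * h) = tensor_mult (\<Delta> g) (\<Delta> h)"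
    and comult_one: "\<Delta> 1 = 1 \<otimes> 1"
    and counit_mult: "\<epsilon> (g * h) = \<epsilon> g * \<epsilon> h"
    and counit_one: "\<epsilon> 1 = 1"
    and antipode_left: "tensor_lift (\<lambda>h0 h1. S h0 * h1) (\<Delta> h) = \<epsilon> h *\<^sub>C 1"
    and antipode_right: "tensor_lift (\<lambda>h0 h1. h0 * S h1) (\<Delta> h) = \<epsilon> h *\<^sub>C 1"

definition character :: "('h::complex_algebra_1 \<Rightarrow> complex) \<Rightarrow> bool"
  where "character \<delta> \<longleftrightarrow>
    clinear \<delta> \<and> (\<forall>g h. \<delta> (g * h) = \<delta> g * \<delta> h) \<and> (\<exists>h. \<delta> h \<noteq> 0)"

definition twisted_antipode ::
  "('h::complex_algebra_1 \<Rightarrow> ('h, 'h) tensor) \<Rightarrow> ('h \<Rightarrow> 'h) \<Rightarrow> ('h \<Rightarrow> complex) \<Rightarrow> 'h \<Rightarrow> 'h"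
  where "twisted_antipode \<Delta> S \<delta> h = tensor_lift (\<lambda>h0 h1. \<delta> h0 *\<^sub>C S h1) (\<Delta> h)"

locale H_module =
  fixes act :: "'h::complex_algebra_1 \<Rightarrow> 'v::complex_vector \<Rightarrow> 'v"
  assumes act_bilinear: "cbilinear act"
    and act_mult: "act (g * h) v = act g (act h v)"
    and act_one: "act 1 v = v"

locale H_algebra = H_module act
  for act :: "'h::complex_algebra_1 \<Rightarrow> 'r::complex_algebra \<Rightarrow> 'r" +
  fixes \<Delta> :: "'h \<Rightarrow> ('h, 'h) tensor"
  assumes act_flat: "act h (a * b) = tensor_lift (\<lambda>h0 h1. act h0 a * act h1 b) (\<Delta> h)"

section \<open>Localization\<close>

text \<open>The localization of an \<open>H\<close>-module whose underlying space is the subspace \<open>V\<close> of the ambient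
  type: cosets in \<open>V\<close> of the subspace spanned by all \<open>h v - \<delta>(h) v\<close>.\<close>

definition localization_kernel ::
  "('h \<Rightarrow> 'v::complex_vector \<Rightarrow> 'v) \<Rightarrow> ('h \<Rightarrow> complex) \<Rightarrow> 'v set \<Rightarrow> 'v set"
  where "localization_kernel act \<delta> V =
    complex_vector.span {act h v - \<delta> h *\<^sub>C v | h v. v \<in> V}"

definition localization_class ::
  "('h \<Rightarrow> 'v::complex_vector \<Rightarrow> 'v) \<Rightarrow> ('h \<Rightarrow> complex) \<Rightarrow> 'v set \<Rightarrow> 'v \<Rightarrow> 'v set"
  where "localization_class act \<delta> V v = v +o localization_kernel act \<delta> V"

definition localization ::
  "('h \<Rightarrow> 'v::complex_vector \<Rightarrow> 'v) \<Rightarrow> ('h \<Rightarrow> complex) \<Rightarrow> 'v set \<Rightarrow> 'v set set"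
  where "localization act \<delta> V = localization_class act \<delta> V ` V"

text \<open>An operator on \<open>V\<close> descends if it induces a map making the square with the projection
  commute. The projection being linear and onto, the induced map of a linear operator is unique on
  the localization and automatically linear.\<close>

definition descends_to_localization ::
  "('h \<Rightarrow> 'v::complex_vector \<Rightarrow> 'v) \<Rightarrow> ('h \<Rightarrow> complex) \<Rightarrow> 'v set \<Rightarrow> ('v \<Rightarrow> 'v) \<Rightarrow> bool"
  where "descends_to_localization act \<delta> V T \<longleftrightarrow>
    (\<forall>v\<in>V. T v \<in> V) \<and>
    (\<exists>T'. (\<forall>X\<in>localization act \<delta> V. T' X \<in> localization act \<delta> V) \<and>
      (\<forall>v\<in>V. T' (localization_class act \<delta> V v) = localization_class act \<delta> V (T v)))"

section \<open>Adjoining a unit\<close>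

datatype 'r unitization = Unitization (scalar_part: complex) (algebra_part: 'r)

instantiation unitization :: (complex_algebra) complex_algebra_1
begin
definition "0 = Unitization 0 0"
definition "1 = Unitization 1 0"
definition "x + y = Unitization (scalar_part x + scalar_part y) (algebra_part x + algebra_part y)"
definition "x - y = Unitization (scalar_part x - scalar_part y) (algebra_part x - algebra_part y)"
definition "- x = Unitization (- scalar_part x) (- algebra_part x)"
definition "c *\<^sub>C x = Unitization (c * scalar_part x) (c *\<^sub>C algebra_part x)"
definition "x * y = Unitization (scalar_part x * scalar_part y)
  (scalar_part x *\<^sub>C algebra_part y + scalar_part y *\<^sub>C algebra_part x
    + algebra_part x * algebra_part y)"
instance
  by standard
    (simp_all add: zero_unitization_def one_unitization_def plus_unitization_def
      minus_unitization_def uminus_unitization_def scaleC_unitization_def times_unitization_def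
      unitization.expand algebra_simps mult_scaleC_left mult_scaleC_right scaleC_add_right
      scaleC_add_left scaleC_scaleC scaleC_one)
end

abbreviation unitization_of :: "'r \<Rightarrow> 'r::complex_algebra unitization"
  where "unitization_of r \<equiv> Unitization 0 r"

definition unitization_act ::
  "('h \<Rightarrow> complex) \<Rightarrow> ('h \<Rightarrow> 'r \<Rightarrow> 'r) \<Rightarrow> 'h \<Rightarrow> 'r::complex_algebra unitization \<Rightarrow> 'r unitization"
  where "unitization_act \<epsilon> act h x =
    Unitization (\<epsilon> h * scalar_part x) (act h (algebra_part x))"

section \<open>Non-commutative differential forms\<close>

text \<open>The type \<open>'r uforms\<close> is the direct sum over \<open>n \<ge> 0\<close> of \<open>R\<^sup>~ \<otimes> R\<^sup>\<otimes>\<^sup>n\<close>, \<open>R\<^sup>~\<close> being the unitization: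
  the free vector space on the symbols \<open>(a\<^sub>0, [a\<^sub>1, \<dots>, a\<^sub>n])\<close> modulo linearity in each of the \<open>n + 1\<close>
  places. It exceeds \<open>\<Omega>\<^sup>*(R)\<close> only by the line spanned by the unit in degree \<open>0\<close>. That line is needed
  to read \<open>b(\<omega> da)\<close> for \<open>da = 1 da\<close>, where \<open>\<omega> = 1\<close>. The forms themselves are the subspace
  \<open>forms\<close> below.\<close>

definition uforms_relations :: "('r::complex_algebra unitization \<times> 'r list \<Rightarrow>\<^sub>0 complex) set"
  where "uforms_relations =
    {Poly_Mapping.single (c *\<^sub>C a + a', as) 1 - c *\<^sub>C Poly_Mapping.single (a, as) 1
      - Poly_Mapping.single (a', as) 1 | c a a' as. True} \<union>
    {Poly_Mapping.single (a, xs @ (c *\<^sub>C x + y) # ys) 1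
      - c *\<^sub>C Poly_Mapping.single (a, xs @ x # ys) 1
      - Poly_Mapping.single (a, xs @ y # ys) 1 | c a x y xs ys. True}"

definition uforms_rel ::
  "('r::complex_algebra unitization \<times> 'r list \<Rightarrow>\<^sub>0 complex)
    \<Rightarrow> ('r unitization \<times> 'r list \<Rightarrow>\<^sub>0 complex) \<Rightarrow> bool"
  where "uforms_rel p q \<longleftrightarrow> p - q \<in> complex_vector.span uforms_relations"

quotient_type (overloaded) 'r uforms =
  "('r::complex_algebra unitization \<times> 'r list) \<Rightarrow>\<^sub>0 complex" / uforms_rel
  unfolding uforms_rel_def[abs_def] by (rule span_rel_equivp)

instantiation uforms :: (complex_algebra) complex_vector
begin
lift_definition zero_uforms :: "'a uforms" is 0 .
lift_definition plus_uforms :: "'a uforms \<Rightarrow> 'a uforms \<Rightarrow> 'a uforms"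
  is "(+)" unfolding uforms_rel_def by (rule span_rel_add)
lift_definition minus_uforms :: "'a uforms \<Rightarrow> 'a uforms \<Rightarrow> 'a uforms"
  is "(-)" unfolding uforms_rel_def by (rule span_rel_diff)
lift_definition uminus_uforms :: "'a uforms \<Rightarrow> 'a uforms"
  is uminus unfolding uforms_rel_def by (rule span_rel_uminus)
lift_definition scaleC_uforms :: "complex \<Rightarrow> 'a uforms \<Rightarrow> 'a uforms"
  is "(*\<^sub>C)" unfolding uforms_rel_def by (rule span_rel_scaleC)
instance
  by standard
    (transfer; simp add: uforms_rel_def complex_vector.span_zero add_ac scaleC_add_right
      scaleC_add_left scaleC_scaleC scaleC_one)+
end

text \<open>\<open>form a\<^sub>0 [a\<^sub>1, \<dots>, a\<^sub>n]\<close> is \<open>a\<^sub>0 da\<^sub>1 \<cdots> da\<^sub>n\<close>.\<close>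

lift_definition form :: "'r::complex_algebra unitization \<Rightarrow> 'r list \<Rightarrow> 'r uforms"
  is "\<lambda>a as. Poly_Mapping.single (a, as) 1" .

definition cmultilinear ::
  "('r::complex_algebra unitization \<Rightarrow> 'r list \<Rightarrow> 'v::complex_vector) \<Rightarrow> bool"
  where "cmultilinear f \<longleftrightarrow>
    (\<forall>as. clinear (\<lambda>a. f a as)) \<and> (\<forall>a xs ys. clinear (\<lambda>x. f a (xs @ x # ys)))"

text \<open>The linear map with \<open>a\<^sub>0 da\<^sub>1 \<cdots> da\<^sub>n \<mapsto> f a\<^sub>0 [a\<^sub>1, \<dots>, a\<^sub>n]\<close>, for multilinear \<open>f\<close>.\<close>

definition form_lift ::
  "('r::complex_algebra unitization \<Rightarrow> 'r list \<Rightarrow> 'v::complex_vector) \<Rightarrow> 'r uforms \<Rightarrow> 'v"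
  where "form_lift f \<omega> = free_lift (case_prod f) (rep_uforms \<omega>)"

lemma form_lift_abs:
  assumes "cmultilinear f"
  shows "form_lift f (abs_uforms p) = free_lift (case_prod f) p"
proof -
  have "uforms_rel (rep_uforms (abs_uforms p)) p"
    by (rule Quotient3_rep_abs[OF Quotient3_uforms]) (simp add: uforms_rel_def complex_vector.span_zero)
  then have "free_lift (case_prod f) (rep_uforms (abs_uforms p) - p) = 0"
    unfolding uforms_rel_def
    by (rule free_lift_span[rotated])
      (use assms in \<open>auto simp: uforms_relations_def cmultilinear_def clinear_iff scaleC_one
        clinear_diff[OF clinear_free_lift] clinear_scale[OF clinear_free_lift]\<close>)
  then show ?thesis
    by (simp add: form_lift_def clinear_diff[OF clinear_free_lift])
qed

lemma form_lift_form [simp]: "cmultilinear f \<Longrightarrow> form_lift f (form a as) = f a as"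
  unfolding form.abs_eq by (simp add: form_lift_abs scaleC_one)

lemma clinear_form_lift:
  assumes "cmultilinear f" shows "clinear (form_lift f)"
proof (rule clinearI)
  fix s t :: "'a uforms" and c
  obtain p q where [simp]: "s = abs_uforms p" "t = abs_uforms q"
    by (metis Quotient3_abs_rep[OF Quotient3_uforms])
  show "form_lift f (s + t) = form_lift f s + form_lift f t"
    by (simp add: plus_uforms.abs_eq form_lift_abs[OF assms] clinear_add[OF clinear_free_lift])
  show "form_lift f (c *\<^sub>C s) = c *\<^sub>C form_lift f s"
    by (simp add: scaleC_uforms.abs_eq form_lift_abs[OF assms] clinear_scale[OF clinear_free_lift])
qed

lemma cmultilinearI:
  assumes "\<And>as. clinear (\<lambda>a. f a as)" "\<And>a xs ys. clinear (\<lambda>x. f a (xs @ x # ys))"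
  shows "cmultilinear f"
  using assms by (simp add: cmultilinear_def)

lemma cmultilinear_form: "cmultilinear form"
proof (intro cmultilinearI)
  have ab: "abs_uforms p = abs_uforms q" if "p - q \<in> uforms_relations"
    for p q :: "('a unitization \<times> 'a list) \<Rightarrow>\<^sub>0 complex"
    using that complex_vector.span_base
    by (simp add: uforms.abs_eq_iff uforms_rel_def)
  have *: "form (c *\<^sub>C a + a') as = c *\<^sub>C form a as + form a' as"
    for c and a a' :: "'a unitization" and as
    unfolding form.abs_eq scaleC_uforms.abs_eq plus_uforms.abs_eq
    by (rule ab) (unfold uforms_relations_def diff_diff_eq, blast)
  have **: "form a (xs @ (c *\<^sub>C x + y) # ys)
      = c *\<^sub>C form a (xs @ x # ys) + form a (xs @ y # ys)"
    for c and a :: "'a unitization" and x y xs ys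
    unfolding form.abs_eq scaleC_uforms.abs_eq plus_uforms.abs_eq
    by (rule ab) (unfold uforms_relations_def diff_diff_eq, blast)
  show "clinear (\<lambda>a :: 'a unitization. form a as)" for as by (rule clinearI_combination) (rule *)
  show "clinear (\<lambda>x. form (a :: 'a unitization) (xs @ x # ys))" for a xs ys by (rule clinearI_combination) (rule **)
qed

lemma uforms_eqI:
  assumes "clinear f" "clinear g" "\<And>a as. f (form a as) = g (form a as)"
  shows "f \<omega> = g \<omega>"
proof -
  obtain p where t: "\<omega> = abs_uforms p"
    by (metis Quotient3_abs_rep[OF Quotient3_uforms])
  have abs: "clinear (abs_uforms :: _ \<Rightarrow> 'a uforms)"
    by (rule clinearI) (simp_all add: plus_uforms.abs_eq scaleC_uforms.abs_eq)
  have "\<omega> = (\<Sum>(a, as)\<in>Poly_Mapping.keys p. Poly_Mapping.lookup p (a, as) *\<^sub>C form a as)"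
    unfolding t by (subst free_lift_generate)
      (simp add: free_lift_def clinear_linear_combination[OF abs] form.abs_eq case_prod_beta)
  then show ?thesis
    by (simp add: case_prod_beta clinear_linear_combination[OF assms(1)]
        clinear_linear_combination[OF assms(2)] assms(3))
qed

lemma clinear_form_lift_param:
  assumes "\<And>a as. clinear (\<lambda>x. g x a as)"
  shows "clinear (\<lambda>x. form_lift (g x) \<omega>)"
  unfolding form_lift_def free_lift_def case_prod_beta
  by (intro clinear_sum clinear_compose[OF clinear_scaleC] assms)

lemma clinear_form_left: "clinear f \<Longrightarrow> clinear (\<lambda>x. form (f x) as)"
  by (rule clinear_compose) (use cmultilinear_form in \<open>auto simp: cmultilinear_def\<close>)

lemma clinear_form_slot: "clinear f \<Longrightarrow> clinear (\<lambda>x. form a (xs @ f x # ys))"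
  by (rule clinear_compose[where f = "\<lambda>x. form a (xs @ x # ys)"])
    (use cmultilinear_form in \<open>auto simp: cmultilinear_def\<close>)

lemma clinear_mult_left: "clinear (\<lambda>x. x * y)" and clinear_mult_right: "clinear (\<lambda>x. y * x)"
  for y :: "'a::complex_algebra"
  by (simp_all add: clinear_iff algebra_simps mult_scaleC_left mult_scaleC_right)

lemma clinear_unitization_of: "clinear (\<lambda>x :: 'r::complex_algebra. unitization_of x)"
  by (simp add: clinear_iff plus_unitization_def scaleC_unitization_def)

lemma clinear_algebra_part: "clinear (algebra_part :: 'r::complex_algebra unitization \<Rightarrow> 'r)"
  by (simp add: clinear_iff plus_unitization_def scaleC_unitization_def)

text \<open>The \<open>n\<close>-forms: \<open>\<Omega>\<^sup>0(R) = R\<close> and \<open>\<Omega>\<^sup>n(R) = R\<^sup>~ \<otimes> R\<^sup>\<otimes>\<^sup>n\<close> for \<open>n \<ge> 1\<close>.\<close>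

definition forms_degree :: "nat \<Rightarrow> 'r::complex_algebra uforms set"
  where "forms_degree n = (if n = 0 then {form (unitization_of a) [] | a. True}
    else complex_vector.span {form a as | a as. length as = n})"

definition forms :: "'r::complex_algebra uforms set"
  where "forms = complex_vector.span (\<Union>n. forms_degree n)"

section \<open>Bimodule structure and operators\<close>

text \<open>\<open>form_times_d \<omega> x\<close> is \<open>\<omega> dx\<close>.\<close>

definition form_times_d :: "'r::complex_algebra uforms \<Rightarrow> 'r \<Rightarrow> 'r uforms"
  where "form_times_d \<omega> x = form_lift (\<lambda>a as. form a (as @ [x])) \<omega>"

lemma cmultilinear_times_d: "cmultilinear (\<lambda>a as. form a (as @ [x]))"
  by (rule cmultilinearI) (simp_all add: clinear_form_left clinear_form_slot clinear_id)

lemma form_times_d_form [simp]: "form_times_d (form a as) x = form a (as @ [x])"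
  by (simp add: form_times_d_def cmultilinear_times_d)

lemma cbilinear_times_d: "cbilinear form_times_d"
  unfolding form_times_d_def
  by (intro cbilinearI clinear_form_lift_param clinear_form_lift cmultilinear_times_d
      clinear_form_slot[of "\<lambda>x. x"] clinear_id)

definition form_mult_left :: "'r::complex_algebra \<Rightarrow> 'r uforms \<Rightarrow> 'r uforms"
  where "form_mult_left x \<omega> = form_lift (\<lambda>a as. form (unitization_of x * a) as) \<omega>"

lemma cmultilinear_mult_left: "cmultilinear (\<lambda>a as. form (unitization_of x * a) as)"
  by (rule cmultilinearI)
    (simp_all add: clinear_form_left clinear_mult_right clinear_form_slot clinear_id)

lemma form_mult_left_form [simp]:
  "form_mult_left x (form a as) = form (unitization_of x * a) as"
  by (simp add: form_mult_left_def cmultilinear_mult_left)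

lemma cbilinear_mult_left: "cbilinear form_mult_left"
  unfolding form_mult_left_def
  by (intro cbilinearI clinear_form_lift_param clinear_form_lift cmultilinear_mult_left
      clinear_form_left clinear_compose[OF clinear_mult_left] clinear_unitization_of)

text \<open>The product \<open>(a\<^sub>0 da\<^sub>1 \<cdots> da\<^sub>n) x\<close>, computed from the right by \<open>(da) x = d(a x) - a dx\<close>; the
  list is \<open>[a\<^sub>n, \<dots>, a\<^sub>1]\<close>. The two rules characterizing it are
  \<open>form_mult_right_form_Nil\<close> and \<open>form_mult_right_times_d\<close>.\<close>

primrec form_mult_right_rev ::
  "'r::complex_algebra unitization \<Rightarrow> 'r list \<Rightarrow> 'r \<Rightarrow> 'r uforms" where
  "form_mult_right_rev a0 [] x = form (a0 * unitization_of x) []"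
| "form_mult_right_rev a0 (a # as) x =
    form a0 (rev as @ [a * x]) - form_times_d (form_mult_right_rev a0 as a) x"

definition form_mult_right :: "'r::complex_algebra uforms \<Rightarrow> 'r \<Rightarrow> 'r uforms"
  where "form_mult_right \<omega> x = form_lift (\<lambda>a as. form_mult_right_rev a (rev as) x) \<omega>"

lemma clinear_mult_right_rev:
  "clinear (\<lambda>x. form_mult_right_rev a as x)"
  "clinear (\<lambda>a. form_mult_right_rev a as x)"
proof (induction as arbitrary: x)
  case Nil
  { case 1 show ?case
      by (simp add: clinear_form_left clinear_compose[OF clinear_mult_right clinear_unitization_of]) }
  { case 2 show ?case
      by (simp add: clinear_form_left clinear_mult_left) }
next
  case (Cons b as)
  { case 1 show ?case
      by (simp add: clinear_minus clinear_form_slot clinear_mult_right cbilinear_right[OF cbilinear_times_d]) }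
  { case 2 show ?case
      by (simp add: clinear_minus clinear_form_left clinear_id
          clinear_compose[OF cbilinear_left[OF cbilinear_times_d] Cons.IH(2)]) }
qed

lemma clinear_mult_right_rev_slot:
  "clinear (\<lambda>z. form_mult_right_rev a (xs @ z # ys) x)"
proof (induction xs arbitrary: x)
  case Nil
  show ?case
    by (simp add: clinear_minus clinear_form_slot clinear_mult_left
        clinear_compose[OF cbilinear_left[OF cbilinear_times_d] clinear_mult_right_rev(1)])
next
  case (Cons b xs)
  show ?case
    by (simp add: clinear_minus clinear_form_slot clinear_id
        clinear_compose[OF cbilinear_left[OF cbilinear_times_d] Cons.IH])
qed

lemma cmultilinear_mult_right: "cmultilinear (\<lambda>a as. form_mult_right_rev a (rev as) x)"
  by (rule cmultilinearI) (simp_all add: clinear_mult_right_rev clinear_mult_right_rev_slot)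

lemma cbilinear_mult_right: "cbilinear form_mult_right"
  unfolding form_mult_right_def
  by (intro cbilinearI clinear_form_lift_param clinear_form_lift cmultilinear_mult_right
      clinear_mult_right_rev)

lemma form_mult_right_form_Nil: "form_mult_right (form a []) x = form (a * unitization_of x) []"
  by (simp add: form_mult_right_def cmultilinear_mult_right)

lemma form_mult_right_times_d:
  "form_mult_right (form_times_d \<omega> a) x =
    form_times_d \<omega> (a * x) - form_times_d (form_mult_right \<omega> a) x"
proof (rule uforms_eqI[where \<omega> = \<omega> and f = "\<lambda>\<omega>. form_mult_right (form_times_d \<omega> a) x"
      and g = "\<lambda>\<omega>. form_times_d \<omega> (a * x) - form_times_d (form_mult_right \<omega> a) x"])
  show "clinear (\<lambda>\<omega>. form_mult_right (form_times_d \<omega> a) x)"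
    by (intro clinear_compose[OF cbilinear_left[OF cbilinear_mult_right]]
        cbilinear_left[OF cbilinear_times_d])
  show "clinear (\<lambda>\<omega>. form_times_d \<omega> (a * x) - form_times_d (form_mult_right \<omega> a) x)"
    by (intro clinear_minus clinear_compose[OF cbilinear_left[OF cbilinear_times_d]]
        cbilinear_left[OF cbilinear_mult_right] cbilinear_left[OF cbilinear_times_d])
qed (simp add: form_mult_right_def cmultilinear_mult_right)

text \<open>The scalar part of \<open>a\<^sub>0\<close> is dropped because \<open>d1 = 0\<close>.\<close>

definition form_d :: "'r::complex_algebra uforms \<Rightarrow> 'r uforms"
  where "form_d = form_lift (\<lambda>a as. form 1 (algebra_part a # as))"

lemma cmultilinear_d: "cmultilinear (\<lambda>a as. form 1 (algebra_part a # as))"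
proof (rule cmultilinearI)
  show "clinear (\<lambda>a. form 1 (algebra_part a # as))" for as :: "'a list"
    using clinear_form_slot[OF clinear_algebra_part, of 1 "[]"] by simp
  show "clinear (\<lambda>x. form 1 (algebra_part a # xs @ x # ys))"
    for a :: "'a unitization" and xs ys
    using clinear_form_slot[OF clinear_id, of 1 "algebra_part a # xs"] by simp
qed

lemma form_d_form: "form_d (form a as) = form 1 (algebra_part a # as)"
  by (simp add: form_d_def cmultilinear_d)

lemma clinear_form_d: "clinear form_d"
  unfolding form_d_def by (rule clinear_form_lift[OF cmultilinear_d])

definition form_b :: "'r::complex_algebra uforms \<Rightarrow> 'r uforms"
  where "form_b = form_lift (\<lambda>a as. if as = [] then 0
    else let \<omega> = form a (butlast as); x = last as in
      (-1) ^ length (butlast as) *\<^sub>C (form_mult_right \<omega> x - form_mult_left x \<omega>))"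

lemma cmultilinear_b: "cmultilinear (\<lambda>a as. if as = [] then 0
    else let \<omega> = form a (butlast as); x = last as in
      (-1) ^ length (butlast as) *\<^sub>C (form_mult_right \<omega> x - form_mult_left x \<omega>))"
proof (rule cmultilinearI)
  fix as :: "'a list"
  show "clinear (\<lambda>a. if as = [] then 0 else let \<omega> = form a (butlast as); x = last as in
      (-1) ^ length (butlast as) *\<^sub>C (form_mult_right \<omega> x - form_mult_left x \<omega>))"
    by (cases "as = []")
      (simp_all del: form_mult_left_form add: Let_def clinear_zero clinear_id clinear_form_left
        clinear_compose[OF clinear_scaleC] clinear_minus
        clinear_compose[OF cbilinear_left[OF cbilinear_mult_right]]
        clinear_compose[OF cbilinear_right[OF cbilinear_mult_left]])
next
  fix a :: "'a unitization" and xs ys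
  show "clinear (\<lambda>z. if xs @ z # ys = [] then 0
      else let \<omega> = form a (butlast (xs @ z # ys)); x = last (xs @ z # ys) in
      (-1) ^ length (butlast (xs @ z # ys)) *\<^sub>C (form_mult_right \<omega> x - form_mult_left x \<omega>))"
    by (cases ys rule: rev_cases)
      (simp_all del: form_mult_left_form add: Let_def butlast_append clinear_uminus clinear_compose[OF clinear_scaleC] clinear_minus clinear_id
        clinear_form_slot cbilinear_right[OF cbilinear_mult_right]
        cbilinear_left[OF cbilinear_mult_left]
        clinear_compose[OF cbilinear_left[OF cbilinear_mult_right]]
        clinear_compose[OF cbilinear_right[OF cbilinear_mult_left]])
qed

lemma clinear_form_b: "clinear form_b"
  unfolding form_b_def by (rule clinear_form_lift[OF cmultilinear_b])

lemma form_b_form_Nil: "form_b (form a []) = 0"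
  by (simp add: form_b_def cmultilinear_b)

lemma form_b_form_snoc:
  "form_b (form_times_d (form a as) x) =
    (-1) ^ length as *\<^sub>C (form_mult_right (form a as) x - form_mult_left x (form a as))"
  by (simp add: form_b_def cmultilinear_b)

definition form_k :: "'r::complex_algebra uforms \<Rightarrow> 'r uforms"
  where "form_k \<omega> = \<omega> - (form_b (form_d \<omega>) + form_d (form_b \<omega>))"

lemma clinear_form_k: "clinear form_k"
  unfolding form_k_def[abs_def]
  by (intro clinear_minus clinear_plus clinear_id clinear_compose[OF clinear_form_b]
      clinear_compose[OF clinear_form_d] clinear_form_b clinear_form_d)

definition form_B :: "'r::complex_algebra uforms \<Rightarrow> 'r uforms"
  where "form_B = form_lift (\<lambda>a as. \<Sum>i\<le>length as. (form_k ^^ i) (form_d (form a as)))"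

lemma cmultilinear_B: "cmultilinear (\<lambda>a as. \<Sum>i\<le>length as. (form_k ^^ i) (form_d (form a as)))"
proof -
  have "clinear (form_k ^^ i :: 'a uforms \<Rightarrow> _)" for i
    by (induction i) (simp_all add: clinear_id clinear_form_k clinear_compose id_def comp_def)
  then show ?thesis
    by (intro cmultilinearI)
      (simp_all del: sum.atMost_Suc add: clinear_sum clinear_compose[of "form_k ^^ _"]
        clinear_compose[OF clinear_form_d] clinear_form_left clinear_form_slot clinear_id)
qed

lemma form_B_form:
  "form_B (form a as) = (\<Sum>i\<le>length as. (form_k ^^ i) (form_d (form a as)))"
  by (simp add: form_B_def cmultilinear_B)

text \<open>The diagonal action
  \<open>h (a\<^sub>0 da\<^sub>1 \<cdots> da\<^sub>n) = \<Sum> h\<^sub>0(a\<^sub>0) d(h\<^sub>1(a\<^sub>1)) \<cdots> d(h\<^sub>n(a\<^sub>n))\<close>, with the iterated coproduct of \<open>h\<close>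
  formed by splitting off one factor at a time from the right; the list is \<open>[a\<^sub>n, \<dots>, a\<^sub>1]\<close>.\<close>

primrec form_act_rev ::
  "('h::complex_algebra_1 \<Rightarrow> ('h, 'h) tensor) \<Rightarrow> ('h \<Rightarrow> complex) \<Rightarrow> ('h \<Rightarrow> 'r \<Rightarrow> 'r)
    \<Rightarrow> 'r::complex_algebra unitization \<Rightarrow> 'r list \<Rightarrow> 'h \<Rightarrow> 'r uforms" where
  "form_act_rev \<Delta> \<epsilon> act a0 [] h = form (unitization_act \<epsilon> act h a0) []"
| "form_act_rev \<Delta> \<epsilon> act a0 (a # as) h =
    tensor_lift (\<lambda>h0 h1. form_times_d (form_act_rev \<Delta> \<epsilon> act a0 as h0) (act h1 a)) (\<Delta> h)"

definition form_act ::
  "('h::complex_algebra_1 \<Rightarrow> ('h, 'h) tensor) \<Rightarrow> ('h \<Rightarrow> complex) \<Rightarrow> ('h \<Rightarrow> 'r \<Rightarrow> 'r)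
    \<Rightarrow> 'h \<Rightarrow> 'r::complex_algebra uforms \<Rightarrow> 'r uforms"
  where "form_act \<Delta> \<epsilon> act h = form_lift (\<lambda>a as. form_act_rev \<Delta> \<epsilon> act a (rev as) h)"

context
  fixes \<Delta> :: "'h::complex_algebra_1 \<Rightarrow> ('h, 'h) tensor" and \<epsilon> :: "'h \<Rightarrow> complex"
    and act :: "'h \<Rightarrow> 'r::complex_algebra \<Rightarrow> 'r"
  assumes lin: "clinear \<Delta>" "clinear \<epsilon>" "cbilinear act"
begin

lemma cbilinear_unitization_act: "cbilinear (unitization_act \<epsilon> act)"
  using lin
  by (intro cbilinearI clinearI)
    (simp_all add: unitization_act_def plus_unitization_def scaleC_unitization_def clinear_iff
      cbilinear_def algebra_simps scaleC_complex_def)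

lemma clinear_form_act_rev_algebra: "clinear (form_act_rev \<Delta> \<epsilon> act a as)"
  and cbilinear_form_act_step: "cbilinear (\<lambda>h0 h1. form_times_d (form_act_rev \<Delta> \<epsilon> act a as h0) (act h1 x))"
proof (induction as arbitrary: x)
  case Nil
  { case 1 show ?case
      using clinear_form_left[OF cbilinear_left[OF cbilinear_unitization_act]]
      by (simp add: clinear_iff) }
  note * = this
  { case 2 show ?case
      by (intro cbilinearI clinear_compose[OF cbilinear_left[OF cbilinear_times_d] *]
          clinear_compose[OF cbilinear_right[OF cbilinear_times_d] cbilinear_left[OF lin(3)]]) }
next
  case (Cons b as)
  { case 1 show ?case
      using clinear_compose[OF clinear_tensor_lift[OF Cons.IH(2)] lin(1)] by (simp add: clinear_iff) }
  note * = this
  { case 2 show ?case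
      by (intro cbilinearI clinear_compose[OF cbilinear_left[OF cbilinear_times_d] *]
          clinear_compose[OF cbilinear_right[OF cbilinear_times_d] cbilinear_left[OF lin(3)]]) }
qed

lemma clinear_form_act_rev_left: "clinear (\<lambda>a. form_act_rev \<Delta> \<epsilon> act a as h)"
proof (induction as arbitrary: h)
  case Nil
  show ?case
    by (simp add: clinear_form_left cbilinear_right[OF cbilinear_unitization_act])
next
  case (Cons b as)
  show ?case
    by (simp add: clinear_tensor_lift_param clinear_compose[OF cbilinear_left[OF cbilinear_times_d] Cons.IH])
qed

lemma clinear_form_act_rev_slot: "clinear (\<lambda>z. form_act_rev \<Delta> \<epsilon> act a (xs @ z # ys) h)"
proof (induction xs arbitrary: h)
  case Nil
  show ?case
    by (simp add: clinear_tensor_lift_param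
        clinear_compose[OF cbilinear_right[OF cbilinear_times_d] cbilinear_right[OF lin(3)]])
next
  case (Cons b xs)
  show ?case
    by (simp add: clinear_tensor_lift_param clinear_compose[OF cbilinear_left[OF cbilinear_times_d] Cons.IH])
qed

lemma cmultilinear_act: "cmultilinear (\<lambda>a as. form_act_rev \<Delta> \<epsilon> act a (rev as) h)"
  by (rule cmultilinearI) (simp_all add: clinear_form_act_rev_left clinear_form_act_rev_slot)

lemma cbilinear_form_act: "cbilinear (form_act \<Delta> \<epsilon> act)"
proof (rule cbilinearI)
  show "clinear (form_act \<Delta> \<epsilon> act h)" for h
    unfolding form_act_def by (rule clinear_form_lift[OF cmultilinear_act])
  show "clinear (\<lambda>h. form_act \<Delta> \<epsilon> act h \<omega>)" for \<omega>
    unfolding form_act_def by (rule clinear_form_lift_param) (rule clinear_form_act_rev_algebra)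
qed

lemma form_act_form_Nil:
  "form_act \<Delta> \<epsilon> act h (form a []) = form (unitization_act \<epsilon> act h a) []"
  by (simp add: form_act_def cmultilinear_act)

lemma form_act_times_d:
  "form_act \<Delta> \<epsilon> act h (form_times_d \<omega> x) =
    tensor_lift (\<lambda>h0 h1. form_times_d (form_act \<Delta> \<epsilon> act h0 \<omega>) (act h1 x)) (\<Delta> h)"
proof (rule uforms_eqI[where \<omega> = \<omega> and f = "\<lambda>\<omega>. form_act \<Delta> \<epsilon> act h (form_times_d \<omega> x)"
      and g = "\<lambda>\<omega>. tensor_lift
        (\<lambda>h0 h1. form_times_d (form_act \<Delta> \<epsilon> act h0 \<omega>) (act h1 x)) (\<Delta> h)"])
  show "clinear (\<lambda>\<omega>. form_act \<Delta> \<epsilon> act h (form_times_d \<omega> x))"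
    by (intro clinear_compose[OF cbilinear_right[OF cbilinear_form_act]]
        cbilinear_left[OF cbilinear_times_d])
  show "clinear (\<lambda>\<omega>. tensor_lift
      (\<lambda>h0 h1. form_times_d (form_act \<Delta> \<epsilon> act h0 \<omega>) (act h1 x)) (\<Delta> h))"
    by (intro clinear_tensor_lift_param clinear_compose[OF cbilinear_left[OF cbilinear_times_d]]
        cbilinear_right[OF cbilinear_form_act])
qed (simp add: form_act_def cmultilinear_act)

end

end

theory Submission
  imports Defs
begin

text \<open>Modulo the subspace spanned by all \<open>h v - \<delta>(h) v\<close> one can integrate by parts:
  \<open>h(x) \<omega> = \<Sum> h\<^sub>0 (x S(h\<^sub>1) \<omega>) \<equiv> x S\<^sub>\<delta>(h) \<omega>\<close>. Since \<open>d\<close> commutes with \<open>H\<close>, everything hinges on \<open>b\<close>,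
  and there on the term \<open>x \<omega>\<close> of the commutator, whose factors the action visits in the wrong order.
  As \<open>S\<^sub>\<delta>\<^sup>2 = id\<close>, write \<open>h\<^sub>0 = S\<^sub>\<delta>(S\<^sub>\<delta>(h\<^sub>0))\<close> and integrate by parts backwards:
  \<open>\<Sum> h\<^sub>1(x) h\<^sub>0(\<omega>) \<equiv> \<Sum> (S\<^sub>\<delta>(h\<^sub>0) h\<^sub>1)(x) \<omega> = \<delta>(h) x \<omega>\<close>.\<close>

section \<open>Linearity and spans\<close>

text \<open>Both sides are sums over the one fixed representative \<open>rep_tensor t\<close>, so
  the identity holds for arbitrary \<open>f\<close> and \<open>g\<close>. The four lemmas that
  follow rest on the same observation.\<close>

lemma tensor_lift_add:
  "tensor_lift (\<lambda>x y. f x y + g x y) t = tensor_lift f t + tensor_lift g t"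
  by (simp add: tensor_lift_def free_lift_def case_prod_beta scaleC_add_right sum.distrib)

lemma tensor_lift_minus:
  "tensor_lift (\<lambda>x y. f x y - g x y) t = tensor_lift f t - tensor_lift g t"
  by (simp add: tensor_lift_def free_lift_def case_prod_beta
      complex_vector.scale_right_diff_distrib sum_subtractf)

lemma clinear_tensor_lift_push:
  assumes "clinear g"
  shows "g (tensor_lift f t) = tensor_lift (\<lambda>x y. g (f x y)) t"
  by (simp add: tensor_lift_def free_lift_def case_prod_beta clinear_linear_combination[OF assms])

lemma tensor_lift_swap:
  "tensor_lift (\<lambda>a b. tensor_lift (\<lambda>c d. f a b c d) t) s =
    tensor_lift (\<lambda>c d. tensor_lift (\<lambda>a b. f a b c d) s) t"
  unfolding tensor_lift_def free_lift_def case_prod_beta complex_vector.scale_sum_right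
  by (subst sum.swap) (simp add: scaleC_scaleC mult.commute)

lemma tensor_lift_mem_span:
  assumes "\<And>x y. f x y \<in> complex_vector.span X"
  shows "tensor_lift f t \<in> complex_vector.span X"
  unfolding tensor_lift_def free_lift_def case_prod_beta
  by (intro complex_vector.span_sum complex_vector.span_scale assms)

lemma clinear_tensor_lift_arg:
  assumes "\<And>x. clinear (f x)" "\<And>y. clinear (\<lambda>x. f x y)" "clinear g"
  shows "clinear (\<lambda>x. tensor_lift f (g x))"
  by (rule clinear_compose[OF clinear_tensor_lift assms(3)]) (intro cbilinearI assms)

text \<open>Together with \<open>comult_mult\<close> this puts \<Delta>(gh) = \<Delta>(g)\<Delta>(h)
  into Sweedler notation.\<close>

lemma tensor_lift_tensor_mult:
  assumes "cbilinear f"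
  shows "tensor_lift f (tensor_mult s t) =
    tensor_lift (\<lambda>a b. tensor_lift (\<lambda>c d. f (a * c) (b * d)) t) s"
  unfolding tensor_mult_def
  by (simp add: clinear_tensor_lift_push[OF clinear_tensor_lift[OF assms]] assms)

lemma clinear_scaleC_left: "clinear f \<Longrightarrow> clinear (\<lambda>x. f x *\<^sub>C v)"
  by (simp add: clinear_iff scaleC_complex_def scaleC_add_left scaleC_scaleC)

lemma clinear_scaleC_right: "clinear f \<Longrightarrow> clinear (\<lambda>x. c *\<^sub>C f x)"
  by (rule clinear_compose[OF clinear_scaleC])

lemma clinear_times_left: "clinear f \<Longrightarrow> clinear (\<lambda>x. f x * (y::'a::complex_algebra))"
  and clinear_times_right: "clinear f \<Longrightarrow> clinear (\<lambda>x. y * f x)"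
  by (rule clinear_compose[OF clinear_mult_left] clinear_compose[OF clinear_mult_right]; assumption)+

lemma clinear_times_d_left: "clinear f \<Longrightarrow> clinear (\<lambda>x. form_times_d (f x) y)"
  and clinear_times_d_right: "clinear g \<Longrightarrow> clinear (\<lambda>x. form_times_d \<omega> (g x))"
  by (rule clinear_compose[OF cbilinear_left[OF cbilinear_times_d]]
      clinear_compose[OF cbilinear_right[OF cbilinear_times_d]]; assumption)+

lemma clinear_form_mult_left_left: "clinear f \<Longrightarrow> clinear (\<lambda>x. form_mult_left (f x) \<omega>)"
  and clinear_form_mult_left_right: "clinear g \<Longrightarrow> clinear (\<lambda>x. form_mult_left y (g x))"
  by (rule clinear_compose[OF cbilinear_left[OF cbilinear_mult_left]]
      clinear_compose[OF cbilinear_right[OF cbilinear_mult_left]]; assumption)+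

lemma clinear_form_mult_right_left: "clinear f \<Longrightarrow> clinear (\<lambda>x. form_mult_right (f x) y)"
  and clinear_form_mult_right_right: "clinear g \<Longrightarrow> clinear (\<lambda>x. form_mult_right \<omega> (g x))"
  by (rule clinear_compose[OF cbilinear_left[OF cbilinear_mult_right]]
      clinear_compose[OF cbilinear_right[OF cbilinear_mult_right]]; assumption)+

lemmas clinear_intros = clinear_id clinear_minus clinear_plus clinear_zero clinear_scaleC_left
  clinear_scaleC_right clinear_times_left clinear_times_right clinear_times_d_left
  clinear_times_d_right clinear_form_mult_left_left clinear_form_mult_left_right
  clinear_form_mult_right_left clinear_form_mult_right_right clinear_form_left
  clinear_tensor_lift_param clinear_tensor_lift_arg clinear_compose[OF clinear_form_d]
  clinear_compose[OF clinear_unitization_of] clinear_compose[OF clinear_algebra_part]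

section \<open>Spanning symbols and induction on the degree\<close>

lemma uforms_span:
  assumes "\<And>a as. form a as \<in> complex_vector.span X"
  shows "\<omega> \<in> complex_vector.span X"
proof -
  \<comment> \<open>\<open>form_lift form\<close> is the identity, and its definition exhibits every
    value as a finite combination of symbols.\<close>
  have "\<omega> = form_lift form \<omega>"
    by (rule uforms_eqI[OF clinear_id clinear_form_lift[OF cmultilinear_form]])
      (simp add: cmultilinear_form)
  also have "\<dots> \<in> complex_vector.span X"
    unfolding form_lift_def free_lift_def case_prod_beta
    by (intro complex_vector.span_sum complex_vector.span_scale assms)
  finally show ?thesis .
qed

text \<open>Induction on the degree, each step appending a last differential. The index
  \<open>i\<close> keeps the acting element, and any further parameter, universally quantified: the
  coproduct replaces h by h0 in the step.\<close>

lemma uforms_eq_induct: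
  assumes lin: "\<And>i. clinear (F i)" "\<And>i. clinear (G i)"
    and Nil: "\<And>i a. F i (form a []) = G i (form a [])"
    and times_d: "\<And>i \<omega> x. (\<And>j. F j \<omega> = G j \<omega>) \<Longrightarrow> F i (form_times_d \<omega> x) = G i (form_times_d \<omega> x)"
  shows "F i \<omega> = G i \<omega>"
proof (rule uforms_eqI[OF lin])
  fix a as
  show "F i (form a as) = G i (form a as)"
  proof (induction as arbitrary: i rule: rev_induct)
    case Nil show ?case by (rule assms)
  next
    case (snoc x xs)
    then show ?case using times_d[of "form a xs" i x] by simp
  qed
qed

lemma clinear_mem_span:
  assumes "clinear f" "\<And>x. x \<in> X \<Longrightarrow> f x \<in> complex_vector.span Y" "x \<in> complex_vector.span X"
  shows "f x \<in> complex_vector.span Y"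
  using assms(3)
proof (induction rule: complex_vector.span_induct_alt)
  case base show ?case by (simp add: clinear_0[OF assms(1)] complex_vector.span_zero)
next
  case (step c x y)
  then show ?case
    by (simp add: clinear_add[OF assms(1)] clinear_scale[OF assms(1)] assms(2)
        complex_vector.span_add complex_vector.span_scale)
qed

lemma clinear_eq_on_span:
  assumes "clinear f" "clinear g" "\<And>x. x \<in> X \<Longrightarrow> f x = g x" "x \<in> complex_vector.span X"
  shows "f x = g x"
  \<comment> \<open>The difference maps \<open>X\<close>, hence its span, into the span of the empty
    set, which is 0.\<close>
  using clinear_mem_span[of "\<lambda>x. f x - g x" X "{}" x] assms by (simp add: clinear_minus)

section \<open>Descending to the localization\<close>

lemma localization_class_eq_iff:
  "localization_class act \<delta> V v = localization_class act \<delta> V w \<longleftrightarrow> v - w \<in> localization_kernel act \<delta> V"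
proof
  let ?K = "localization_kernel act \<delta> V"
  assume "localization_class act \<delta> V v = localization_class act \<delta> V w"
  moreover have "v \<in> v +o ?K"
    by (auto simp: elt_set_plus_def localization_kernel_def intro!: bexI[of _ 0] complex_vector.span_zero)
  ultimately show "v - w \<in> ?K"
    by (auto simp: localization_class_def elt_set_plus_def)
next
  let ?K = "localization_kernel act \<delta> V"
  assume *: "v - w \<in> ?K"
  have "v +o ?K = w +o ?K"
  proof (rule set_eqI)
    fix z
    have iff: "z \<in> u +o ?K \<longleftrightarrow> z - u \<in> ?K" for u
      by (auto simp: elt_set_plus_def intro!: bexI[of _ "z - u"])
    have "z - v \<in> ?K \<longleftrightarrow> z - w \<in> ?K"
      using * complex_vector.span_add[of "z - v" _ "v - w"] complex_vector.span_diff[of "z - w" _ "v - w"]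
      unfolding localization_kernel_def by fastforce
    then show "z \<in> v +o ?K \<longleftrightarrow> z \<in> w +o ?K" by (simp add: iff)
  qed
  then show "localization_class act \<delta> V v = localization_class act \<delta> V w"
    by (simp add: localization_class_def)
qed

lemma descends_to_localizationI:
  assumes lin: "clinear T" and V: "\<And>v. v \<in> V \<Longrightarrow> T v \<in> V"
    and K: "\<And>v. v \<in> localization_kernel act \<delta> V \<Longrightarrow> T v \<in> localization_kernel act \<delta> V"
  shows "descends_to_localization act \<delta> V T"
proof -
  let ?c = "localization_class act \<delta> V"
  \<comment> \<open>A representative in \<open>V\<close> is chosen for each class; invariance of the
    kernel makes the value independent of the choice.\<close>
  define T' where "T' X = ?c (T (SOME v. v \<in> V \<and> ?c v = X))" for X
  have T': "T' (?c v) = ?c (T v)" if "v \<in> V" for v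
  proof -
    define w where "w = (SOME w. w \<in> V \<and> ?c w = ?c v)"
    have "w \<in> V \<and> ?c w = ?c v"
      unfolding w_def by (rule someI[of _ v]) (simp add: that)
    then have "T w - T v \<in> localization_kernel act \<delta> V"
      using K[of "w - v"] by (simp add: localization_class_eq_iff clinear_diff[OF lin])
    then have "?c (T w) = ?c (T v)" by (simp only: localization_class_eq_iff)
    then show ?thesis by (simp only: T'_def w_def)
  qed
  then have "\<forall>X\<in>localization act \<delta> V. T' X \<in> localization act \<delta> V"
    using V by (auto simp: localization_def)
  then show ?thesis using T' V unfolding descends_to_localization_def by blast
qed

lemma localization_kernel_closed:
  assumes "clinear T"
    and "\<And>h v. v \<in> V \<Longrightarrow> T (act h v - \<delta> h *\<^sub>C v) \<in> localization_kernel act \<delta> V"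
    and "v \<in> localization_kernel act \<delta> V"
  shows "T v \<in> localization_kernel act \<delta> V"
  unfolding localization_kernel_def
  by (rule clinear_mem_span[OF assms(1) _ assms(3)[unfolded localization_kernel_def]])
    (use assms(2) in \<open>auto simp: localization_kernel_def\<close>)

section \<open>Forms and their degrees\<close>

lemma forms_form_Nil: "form (unitization_of a) [] \<in> forms"
  unfolding forms_def forms_degree_def by (rule complex_vector.span_base) auto

lemma forms_form: "as \<noteq> [] \<Longrightarrow> form a as \<in> forms"
  unfolding forms_def forms_degree_def
  by (rule complex_vector.span_base, rule UN_I[of "length as"])
    (auto intro: complex_vector.span_base)

text \<open>The symbols span the whole ambient space, including the extra unit line in degree 0.
  Thus the membership lemmas below for \<open>d\<close>, \<open>b\<close>, \<open>B\<close> and the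
  two multiplications hold at every \<omega>.\<close>

lemma clinear_mem_forms:
  assumes "clinear f" "\<And>a as. f (form a as) \<in> forms"
  shows "f \<omega> \<in> forms"
  unfolding forms_def
  by (rule clinear_mem_span[OF assms(1) _ uforms_span[of "range (case_prod form)"]])
    (auto intro: complex_vector.span_base simp: assms(2)[unfolded forms_def])

lemma forms_times_d: "form_times_d \<omega> x \<in> forms"
proof (rule clinear_mem_forms[where f = "\<lambda>\<omega>. form_times_d \<omega> x"])
  show "clinear (\<lambda>\<omega>. form_times_d \<omega> x)" by (intro clinear_intros)
qed (simp add: forms_form)

text \<open>A spanning set adapted to the recursions: degree 0 without scalar part, or a last
  differential to split off. \<open>operator_kernel\<close> tests operators on it.\<close>

lemma forms_eq_span:
  "forms = complex_vector.span
    (range (\<lambda>a. form (unitization_of a) []) \<union> range (\<lambda>(a, as, x). form a (as @ [x])))"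
    (is "_ = complex_vector.span ?X")
proof
  have snoc: "form a as \<in> complex_vector.span ?X" if "as \<noteq> []" for a :: "'a unitization" and as
  proof (rule complex_vector.span_base)
    have "form a as = (\<lambda>(a, as, x). form a (as @ [x])) (a, butlast as, last as)"
      using that by simp
    then show "form a as \<in> ?X" by blast
  qed
  have "forms_degree n \<subseteq> complex_vector.span ?X" for n
  proof (cases "n = 0")
    case True
    then show ?thesis by (auto simp: forms_degree_def intro: complex_vector.span_base)
  next
    case False
    then have "{form a as | a as. length as = n} \<subseteq> complex_vector.span ?X"
      using snoc by auto
    with False show ?thesis
      by (simp add: forms_degree_def complex_vector.span_minimal)
  qed
  then show "forms \<subseteq> complex_vector.span ?X"
    unfolding forms_def by (intro complex_vector.span_minimal) auto
  show "complex_vector.span ?X \<subseteq> forms"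
    by (subst forms_def, rule complex_vector.span_minimal)
      (auto simp: forms_form_Nil[unfolded forms_def] forms_form[unfolded forms_def])
qed

text \<open>Unlike in \<open>forms_degree\<close>, degree 0 here contains the unit, because \<omega>
  = 1 occurs when \<open>1 da\<close> is read as \<omega> da.\<close>

definition uforms_degree :: "nat \<Rightarrow> 'r::complex_algebra uforms set"
  where "uforms_degree n = complex_vector.span {form a as | a as. length as = n}"

lemma form_mem_uforms_degree: "form a as \<in> uforms_degree (length as)"
  unfolding uforms_degree_def by (auto intro: complex_vector.span_base)

lemma form_times_d_mem_uforms_degree:
  assumes "\<omega> \<in> uforms_degree n"
  shows "form_times_d \<omega> x \<in> uforms_degree (Suc n)"
  unfolding uforms_degree_def
proof (rule clinear_mem_span[OF _ _ assms[unfolded uforms_degree_def]])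
  show "clinear (\<lambda>\<omega>. form_times_d \<omega> x)" by (intro clinear_intros)
  fix \<omega> :: "'a uforms" assume "\<omega> \<in> {form a as | a as. length as = n}"
  then show "form_times_d \<omega> x \<in> complex_vector.span {form a as | a as. length as = Suc n}"
    using form_mem_uforms_degree[of _ "_ @ [x]"] by (auto simp: uforms_degree_def)
qed

text \<open>\<open>form_b_form_snoc\<close> covers a single symbol. The sign is constant in a fixed
  degree and both sides are linear in \<omega>, so the rule extends to combinations such as
  \<open>A h0 \<omega>\<close>.\<close>

lemma form_b_times_d:
  assumes "\<omega> \<in> uforms_degree n"
  shows "form_b (form_times_d \<omega> x) = (-1) ^ n *\<^sub>C (form_mult_right \<omega> x - form_mult_left x \<omega>)"
  by (rule clinear_eq_on_span[OF _ _ _ assms[unfolded uforms_degree_def]])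
    (auto intro!: clinear_intros clinear_compose[OF clinear_form_b]
      simp: form_b_form_snoc simp del: form_times_d_form form_mult_left_form)

lemma form_d_times_d: "form_d (form_times_d \<omega> x) = form_times_d (form_d \<omega>) x"
  by (rule uforms_eqI[where \<omega> = \<omega> and f = "\<lambda>\<omega>. form_d (form_times_d \<omega> x)"
        and g = "\<lambda>\<omega>. form_times_d (form_d \<omega>) x"])
    (auto intro!: clinear_intros simp: form_d_form)

lemma form_mult_left_times_d: "form_mult_left y (form_times_d \<omega> x) = form_times_d (form_mult_left y \<omega>) x"
  by (rule uforms_eqI[where \<omega> = \<omega> and f = "\<lambda>\<omega>. form_mult_left y (form_times_d \<omega> x)"
        and g = "\<lambda>\<omega>. form_times_d (form_mult_left y \<omega>) x"])
    (auto intro!: clinear_intros)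

section \<open>Stability of \<open>forms\<close> under the multiplications and the operators\<close>

lemma subspace_forms: "complex_vector.subspace forms"
  unfolding forms_def by (rule complex_vector.subspace_span)

lemma form_d_forms: "form_d \<omega> \<in> forms"
  by (rule clinear_mem_forms[OF clinear_form_d]) (simp add: form_d_form forms_form)

text \<open>R is a two-sided ideal of its unitization; this keeps products in degree 0 off the unit
  line.\<close>

lemma unitization_of_mult:
  "unitization_of x * a = unitization_of (scalar_part a *\<^sub>C x + x * algebra_part a)"
  "a * unitization_of x = unitization_of (scalar_part a *\<^sub>C x + algebra_part a * x)"
  by (simp_all add: times_unitization_def)

lemma form_mult_left_forms: "form_mult_left x \<omega> \<in> forms"
proof -
  have "form_mult_left x (form a as) \<in> forms" for a as
    by (cases "as = []") (simp_all add: forms_form unitization_of_mult forms_form_Nil)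
  then show ?thesis
    by (rule clinear_mem_forms[OF cbilinear_right[OF cbilinear_mult_left]])
qed

lemma form_mult_right_forms: "form_mult_right \<omega> x \<in> forms"
proof -
  have "form_mult_right (form a as) x \<in> forms" for a as
  proof (cases as rule: rev_cases)
    case Nil
    then show ?thesis by (simp add: form_mult_right_form_Nil unitization_of_mult forms_form_Nil)
  next
    case (snoc ys y)
    then show ?thesis
      using form_mult_right_times_d[of "form a ys" y x]
        complex_vector.subspace_diff[OF subspace_forms forms_times_d forms_times_d, of "form a ys" "y * x" "form_mult_right (form a ys) y" x]
      by simp
  qed
  then show ?thesis
    by (rule clinear_mem_forms[where f = "\<lambda>\<omega>. form_mult_right \<omega> x",
          OF cbilinear_left[OF cbilinear_mult_right]])
qed

lemma form_b_forms: "form_b \<omega> \<in> forms"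
proof -
  have "form_b (form a as) \<in> forms" for a :: "'a unitization" and as
  proof (cases as rule: rev_cases)
    case Nil
    then show ?thesis by (simp add: form_b_form_Nil complex_vector.subspace_0[OF subspace_forms])
  next
    case (snoc ys y)
    then show ?thesis
      using form_b_form_snoc[of a ys y] complex_vector.subspace_scale[OF subspace_forms
          complex_vector.subspace_diff[OF subspace_forms form_mult_right_forms form_mult_left_forms],
          of "(-1) ^ length ys" "form a ys" y y "form a ys"]
      by simp
  qed
  then show ?thesis by (rule clinear_mem_forms[OF clinear_form_b])
qed

text \<open>The identity term of \<open>k\<close> is why \<omega> itself must lie in
  \<open>forms\<close>.\<close>

lemma form_k_forms: "\<omega> \<in> forms \<Longrightarrow> form_k \<omega> \<in> forms"
  unfolding form_k_def
  by (intro complex_vector.subspace_diff complex_vector.subspace_add subspace_forms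
      form_b_forms form_d_forms)

text \<open>The number of summands of \<open>B\<close> depends on the degree, so \<open>B\<close> is not a combination of composites
  of \<open>d\<close> and \<open>b\<close>; with \<open>n\<close> fixed it is, and the two agree in degree \<open>n\<close>.\<close>

definition form_B_degree :: "nat \<Rightarrow> 'r::complex_algebra uforms \<Rightarrow> 'r uforms"
  where "form_B_degree n \<omega> = (\<Sum>i\<le>n. (form_k ^^ i) (form_d \<omega>))"

lemma clinear_form_k_funpow: "clinear (form_k ^^ i)"
  by (induction i) (simp_all add: clinear_id clinear_form_k clinear_compose id_def comp_def)

lemma clinear_form_B_degree: "clinear (form_B_degree n)"
  unfolding form_B_degree_def[abs_def]
  by (intro clinear_sum clinear_compose[OF clinear_form_k_funpow] clinear_form_d)

lemma clinear_form_B: "clinear form_B"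
  unfolding form_B_def by (rule clinear_form_lift[OF cmultilinear_B])

lemma form_B_eq_degree: "\<omega> \<in> uforms_degree n \<Longrightarrow> form_B \<omega> = form_B_degree n \<omega>"
  unfolding uforms_degree_def
  by (rule clinear_eq_on_span[OF clinear_form_B clinear_form_B_degree])
    (auto simp: form_B_form form_B_degree_def)

lemma form_k_funpow_forms: "\<omega> \<in> forms \<Longrightarrow> (form_k ^^ i) \<omega> \<in> forms"
  by (induction i) (simp_all add: form_k_forms)

lemma form_B_forms: "form_B \<omega> \<in> forms"
proof -
  have "form_B (form a as) \<in> forms" for a :: "'a unitization" and as
    unfolding form_B_form
    by (intro complex_vector.subspace_sum subspace_forms form_k_funpow_forms form_d_forms)
  then show ?thesis by (rule clinear_mem_forms[OF clinear_form_B])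
qed

section \<open>Sweedler calculus\<close>

context hopf_algebra
begin

text \<open>Both sides are values of the linear map \<open>tensor_lift ?F\<close> induced by the
  trilinear \<open>f\<close>, taken at the two sides of \<open>coassoc\<close>. This is the tool for
  renumbering the Sweedler legs h0, h1, h2.\<close>

lemma coassoc_lift:
  assumes "\<And>y z. clinear (\<lambda>x. f x y z)" "\<And>x z. clinear (\<lambda>y. f x y z)" "\<And>x y. clinear (f x y)"
  shows "tensor_lift (\<lambda>h0 h1. tensor_lift (\<lambda>x y. f x y h1) (\<Delta> h0)) (\<Delta> h) =
    tensor_lift (\<lambda>h0 h1. tensor_lift (f h0) (\<Delta> h1)) (\<Delta> h)"
proof -
  let ?F = "\<lambda>x t. tensor_lift (f x) t"
  have cF: "cbilinear ?F"
    by (intro cbilinearI clinear_tensor_lift_param clinear_tensor_lift_arg assms clinear_id)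
  have cb: "cbilinear (\<lambda>x y. x \<otimes> (y \<otimes> z))" for z :: 'h
    by (intro cbilinearI clinear_tensor_of clinear_id)
  have cl: "clinear (\<lambda>x. \<Delta> x)" by (rule comult_linear)
  \<comment> \<open>The first factor \<open>t\<close> stays an arbitrary tensor, since
    \<open>\<Delta> h0\<close> need not be a pure one.\<close>
  have as: "tensor_lift ?F (tensor_assoc (t \<otimes> z)) = tensor_lift (\<lambda>x y. f x y z) t" for t z
  proof -
    have "tensor_assoc (t \<otimes> z) = tensor_lift (\<lambda>x y. x \<otimes> (y \<otimes> z)) t"
      unfolding tensor_assoc_def
      by (rule tensor_lift_of)
        (intro cbilinearI clinear_tensor_lift_param clinear_tensor_lift_arg clinear_tensor_of clinear_id)
    then show ?thesis
      by (simp add: clinear_tensor_lift_push[OF clinear_tensor_lift[OF cF]] tensor_lift_of[OF cF]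
          cbilinearI assms)
  qed
  have la: "clinear (\<lambda>t. tensor_lift ?F (tensor_assoc t))"
    unfolding tensor_assoc_def
    by (intro clinear_compose[OF clinear_tensor_lift[OF cF]] clinear_tensor_lift_arg
        clinear_tensor_lift_param clinear_tensor_of clinear_id)
  have "tensor_lift ?F (tensor_assoc (tensor_map \<Delta> id (\<Delta> h))) =
      tensor_lift (\<lambda>h0 h1. tensor_lift (\<lambda>x y. f x y h1) (\<Delta> h0)) (\<Delta> h)"
    unfolding tensor_map_def
    by (subst clinear_tensor_lift_push[OF la]) (simp add: as)
  moreover have "tensor_lift ?F (tensor_map id \<Delta> (\<Delta> h)) =
      tensor_lift (\<lambda>h0 h1. tensor_lift (f h0) (\<Delta> h1)) (\<Delta> h)"
    unfolding tensor_map_def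
    by (subst clinear_tensor_lift_push[OF clinear_tensor_lift[OF cF]])
      (simp add: tensor_lift_of[OF cF])
  ultimately show ?thesis by (simp add: coassoc)
qed

lemma counit_left_lift: "clinear f \<Longrightarrow> tensor_lift (\<lambda>h0 h1. \<epsilon> h0 *\<^sub>C f h1) (\<Delta> h) = f h"
  using clinear_tensor_lift_push[of f "\<lambda>h0 h1. \<epsilon> h0 *\<^sub>C h1" "\<Delta> h"]
  by (simp add: clinear_scale counit_left)

lemma counit_right_lift: "clinear f \<Longrightarrow> tensor_lift (\<lambda>h0 h1. \<epsilon> h1 *\<^sub>C f h0) (\<Delta> h) = f h"
  using clinear_tensor_lift_push[of f "\<lambda>h0 h1. \<epsilon> h1 *\<^sub>C h0" "\<Delta> h"]
  by (simp add: clinear_scale counit_right)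

text \<open>In the convolution algebra the twisted antipode is \<delta> * S, so convolving it with
  the identity gives \<delta> * (S * id) = \<delta> * \<epsilon> = \<delta>.\<close>

lemma twisted_antipode_convolution:
  assumes "clinear \<delta>"
  shows "tensor_lift (\<lambda>h0 h1. twisted_antipode \<Delta> S \<delta> h0 * h1) (\<Delta> h) = \<delta> h *\<^sub>C 1"
proof -
  note ci = clinear_intros clinear_compose[OF assms] clinear_compose[OF antipode_linear]
  have "tensor_lift (\<lambda>h0 h1. twisted_antipode \<Delta> S \<delta> h0 * h1) (\<Delta> h) =
      tensor_lift (\<lambda>h0 h1. tensor_lift (\<lambda>x y. \<delta> x *\<^sub>C (S y * h1)) (\<Delta> h0)) (\<Delta> h)"
    unfolding twisted_antipode_def
    by (simp add: clinear_tensor_lift_push[OF clinear_mult_left] mult_scaleC_left)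
  also have "\<dots> = tensor_lift (\<lambda>h0 h1. tensor_lift (\<lambda>x y. \<delta> h0 *\<^sub>C (S x * y)) (\<Delta> h1)) (\<Delta> h)"
    by (rule coassoc_lift) (intro ci)+
  also have "\<dots> = tensor_lift (\<lambda>h0 h1. \<epsilon> h1 *\<^sub>C (\<delta> h0 *\<^sub>C 1)) (\<Delta> h)"
    by (simp add: clinear_tensor_lift_push[OF clinear_scaleC, symmetric] antipode_left
        scaleC_scaleC mult.commute)
  also have "\<dots> = \<delta> h *\<^sub>C 1"
    by (rule counit_right_lift) (intro ci)
  finally show ?thesis .
qed

end

section \<open>The diagonal action on forms\<close>

locale hopf_action = hopf_algebra \<Delta> \<epsilon> S + H_algebra act \<Delta>
  for \<Delta> :: "'h::complex_algebra_1 \<Rightarrow> ('h, 'h) tensor" and \<epsilon> S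
    and act :: "'h \<Rightarrow> 'r::complex_algebra \<Rightarrow> 'r"
begin

abbreviation "A \<equiv> form_act \<Delta> \<epsilon> act"

lemmas cbilinear_A = cbilinear_form_act[OF comult_linear counit_linear act_bilinear]
lemmas cbilinear_unit_act = cbilinear_unitization_act[OF comult_linear counit_linear act_bilinear]
lemmas A_Nil = form_act_form_Nil[OF comult_linear counit_linear act_bilinear]
lemmas A_times_d = form_act_times_d[OF comult_linear counit_linear act_bilinear]

lemmas lin = clinear_intros
  clinear_compose[OF comult_linear] clinear_compose[OF counit_linear]
  clinear_compose[OF antipode_linear]
  clinear_compose[OF cbilinear_left[OF act_bilinear]]
  clinear_compose[OF cbilinear_right[OF act_bilinear]]
  clinear_compose[OF cbilinear_left[OF cbilinear_A]]
  clinear_compose[OF cbilinear_right[OF cbilinear_A]]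
  clinear_compose[OF cbilinear_left[OF cbilinear_unit_act]]
  clinear_compose[OF cbilinear_right[OF cbilinear_unit_act]]

lemma act_scale: "act h (c *\<^sub>C x) = c *\<^sub>C act h x"
  and act_scale_left: "act (c *\<^sub>C h) x = c *\<^sub>C act h x"
  and act_add: "act h (x + y) = act h x + act h y"
  using act_bilinear by (simp_all add: cbilinear_def clinear_iff)

lemma A_mult: "A (g * h) \<omega> = A g (A h \<omega>)"
proof -
  \<comment> \<open>The index is the pair (g, h), as both entries are split by the
    coproduct.\<close>
  let ?F = "\<lambda>i. A (fst i * snd i)" and ?G = "\<lambda>i \<omega>. A (fst i) (A (snd i) \<omega>)"
  have "?F i \<omega> = ?G i \<omega>" for i
  proof (rule uforms_eq_induct[where F = ?F and G = ?G])
    fix i :: "'h \<times> 'h" and \<omega> :: "'r uforms" and x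
    assume IH: "\<And>j. ?F j \<omega> = ?G j \<omega>"
    have IH': "A (g * h) \<omega> = A g (A h \<omega>)" for g h
      using IH[of "(g, h)"] by simp
    obtain g h where i: "i = (g, h)" by fastforce
    have cb: "cbilinear (\<lambda>p q. form_times_d (A p \<omega>) (act q x))"
      by (intro cbilinearI lin)
    have "A (g * h) (form_times_d \<omega> x) = tensor_lift (\<lambda>a b. tensor_lift (\<lambda>c d.
        form_times_d (A a (A c \<omega>)) (act b (act d x))) (\<Delta> h)) (\<Delta> g)"
      by (simp add: IH' A_times_d comult_mult tensor_lift_tensor_mult[OF cb] act_mult)
    \<comment> \<open>Expanding the product puts the sum over \<open>\<Delta> g\<close> outermost,
      acting successively the one over \<open>\<Delta> h\<close>; independent sums commute.\<close>
    also have "\<dots> = tensor_lift (\<lambda>c d. tensor_lift (\<lambda>a b.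
        form_times_d (A a (A c \<omega>)) (act b (act d x))) (\<Delta> g)) (\<Delta> h)"
      by (rule tensor_lift_swap)
    also have "\<dots> = A g (A h (form_times_d \<omega> x))"
      by (simp add: A_times_d clinear_tensor_lift_push[OF cbilinear_right[OF cbilinear_A]])
    finally show "?F i (form_times_d \<omega> x) = ?G i (form_times_d \<omega> x)" by (simp add: i)
  next
    show "?F i (form a []) = ?G i (form a [])" for i a
      by (simp add: A_Nil unitization_act_def counit_mult act_mult mult.assoc)
  qed (intro lin)+
  from this[of "(g, h)"] show ?thesis by simp
qed

lemma A_one: "A 1 \<omega> = \<omega>"
proof (rule uforms_eq_induct[where F = "\<lambda>_::unit. A 1" and G = "\<lambda>_ \<omega>. \<omega>"])
  fix \<omega> :: "'r uforms" and x
  assume IH: "\<And>j::unit. A 1 \<omega> = \<omega>"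
  have "cbilinear (\<lambda>h0 h1. form_times_d (A h0 \<omega>) (act h1 x))" by (intro cbilinearI lin)
  then show "A 1 (form_times_d \<omega> x) = form_times_d \<omega> x"
    using IH by (simp add: A_times_d comult_one act_one)
next
  show "A 1 (form a []) = form a []" for a
    by (simp add: A_Nil unitization_act_def counit_one act_one)
qed (intro lin)+

text \<open>Left multiplication commutes with appending a differential, so the degree step only
  renumbers legs. The content is in degree 0, where flatness treats the algebra part of the
  coefficient and the counit its scalar part.\<close>

lemma A_mult_left:
  "A h (form_mult_left x \<omega>) = tensor_lift (\<lambda>h0 h1. form_mult_left (act h0 x) (A h1 \<omega>)) (\<Delta> h)"
proof (rule uforms_eq_induct[where F = "\<lambda>h \<omega>. A h (form_mult_left x \<omega>)"
      and G = "\<lambda>h \<omega>. tensor_lift (\<lambda>h0 h1. form_mult_left (act h0 x) (A h1 \<omega>)) (\<Delta> h)"])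
  fix h a
  have "tensor_lift (\<lambda>h0 h1. form_mult_left (act h0 x) (A h1 (form a []))) (\<Delta> h) =
      tensor_lift (\<lambda>h0 h1. form (unitization_of (\<epsilon> h1 *\<^sub>C (scalar_part a *\<^sub>C act h0 x)
        + act h0 x * act h1 (algebra_part a))) []) (\<Delta> h)"
    by (simp add: A_Nil unitization_act_def unitization_of_mult scaleC_scaleC)
  also have "\<dots> = form (unitization_of (tensor_lift (\<lambda>h0 h1. \<epsilon> h1 *\<^sub>C (scalar_part a *\<^sub>C act h0 x)
        + act h0 x * act h1 (algebra_part a)) (\<Delta> h))) []"
    by (rule clinear_tensor_lift_push[symmetric]) (intro lin)
  also have "tensor_lift (\<lambda>h0 h1. \<epsilon> h1 *\<^sub>C (scalar_part a *\<^sub>C act h0 x)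
        + act h0 x * act h1 (algebra_part a)) (\<Delta> h) =
      scalar_part a *\<^sub>C act h x + act h (x * algebra_part a)"
    by (subst tensor_lift_add, subst counit_right_lift, intro lin) (simp add: act_flat)
  finally show "A h (form_mult_left x (form a [])) =
      tensor_lift (\<lambda>h0 h1. form_mult_left (act h0 x) (A h1 (form a []))) (\<Delta> h)"
    by (simp add: A_Nil unitization_act_def unitization_of_mult act_scale act_add)
next
  fix h and \<omega> :: "'r uforms" and y
  assume IH: "\<And>h. A h (form_mult_left x \<omega>) =
    tensor_lift (\<lambda>h0 h1. form_mult_left (act h0 x) (A h1 \<omega>)) (\<Delta> h)"
  have "A h (form_mult_left x (form_times_d \<omega> y)) =
      tensor_lift (\<lambda>h0 h1. tensor_lift (\<lambda>p q.
        form_times_d (form_mult_left (act p x) (A q \<omega>)) (act h1 y)) (\<Delta> h0)) (\<Delta> h)"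
    by (simp add: form_mult_left_times_d A_times_d IH
        clinear_tensor_lift_push[OF cbilinear_left[OF cbilinear_times_d]])
  also have "\<dots> = tensor_lift (\<lambda>h0 h1. tensor_lift (\<lambda>p q.
        form_times_d (form_mult_left (act h0 x) (A p \<omega>)) (act q y)) (\<Delta> h1)) (\<Delta> h)"
    by (rule coassoc_lift) (intro lin)+
  also have "\<dots> = tensor_lift (\<lambda>h0 h1. form_mult_left (act h0 x) (A h1 (form_times_d \<omega> y))) (\<Delta> h)"
    by (simp add: form_mult_left_times_d[symmetric] A_times_d
        clinear_tensor_lift_push[OF cbilinear_right[OF cbilinear_mult_left]])
  finally show "A h (form_mult_left x (form_times_d \<omega> y)) =
      tensor_lift (\<lambda>h0 h1. form_mult_left (act h0 x) (A h1 (form_times_d \<omega> y))) (\<Delta> h)" .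
qed (intro lin)+

text \<open>The step uses (\<omega> dy) x = \<omega> d(yx) - (\<omega> y) dx, which calls for the
  induction hypothesis at y instead of x; hence the index is the pair (h, x).\<close>

lemma A_mult_right:
  "A h (form_mult_right \<omega> x) = tensor_lift (\<lambda>h0 h1. form_mult_right (A h0 \<omega>) (act h1 x)) (\<Delta> h)"
proof -
  let ?F = "\<lambda>i \<omega>. A (fst i) (form_mult_right \<omega> (snd i))"
  let ?G = "\<lambda>i \<omega>. tensor_lift (\<lambda>h0 h1. form_mult_right (A h0 \<omega>) (act h1 (snd i))) (\<Delta> (fst i))"
  have "?F i \<omega> = ?G i \<omega>" for i
  proof (rule uforms_eq_induct[where F = ?F and G = ?G])
    fix i :: "'h \<times> 'r" and a
    obtain h x where i: "i = (h, x)" by fastforce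
    have "tensor_lift (\<lambda>h0 h1. form_mult_right (A h0 (form a [])) (act h1 x)) (\<Delta> h) =
        tensor_lift (\<lambda>h0 h1. form (unitization_of (\<epsilon> h0 *\<^sub>C (scalar_part a *\<^sub>C act h1 x)
          + act h0 (algebra_part a) * act h1 x)) []) (\<Delta> h)"
      by (simp add: A_Nil unitization_act_def form_mult_right_form_Nil unitization_of_mult scaleC_scaleC)
    also have "\<dots> = form (unitization_of (tensor_lift (\<lambda>h0 h1. \<epsilon> h0 *\<^sub>C (scalar_part a *\<^sub>C act h1 x)
          + act h0 (algebra_part a) * act h1 x) (\<Delta> h))) []"
      by (rule clinear_tensor_lift_push[symmetric]) (intro lin)
    also have "tensor_lift (\<lambda>h0 h1. \<epsilon> h0 *\<^sub>C (scalar_part a *\<^sub>C act h1 x)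
          + act h0 (algebra_part a) * act h1 x) (\<Delta> h) =
        scalar_part a *\<^sub>C act h x + act h (algebra_part a * x)"
      by (subst tensor_lift_add, subst counit_left_lift, intro lin) (simp add: act_flat)
    finally show "?F i (form a []) = ?G i (form a [])"
      by (simp add: i A_Nil unitization_act_def form_mult_right_form_Nil unitization_of_mult act_scale act_add)
  next
    fix i :: "'h \<times> 'r" and \<omega> :: "'r uforms" and y
    assume IH: "\<And>j. ?F j \<omega> = ?G j \<omega>"
    obtain h x where i: "i = (h, x)" by fastforce
    have IH': "A h (form_mult_right \<omega> x) =
        tensor_lift (\<lambda>h0 h1. form_mult_right (A h0 \<omega>) (act h1 x)) (\<Delta> h)" for h x
      using IH[of "(h, x)"] by simp
    have 1: "A h (form_times_d \<omega> (y * x)) = tensor_lift (\<lambda>h0 h1. tensor_lift (\<lambda>p q.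
          form_times_d (A p \<omega>) (act q y * act h1 x)) (\<Delta> h0)) (\<Delta> h)"
    proof -
      have "A h (form_times_d \<omega> (y * x)) = tensor_lift (\<lambda>h0 h1. tensor_lift (\<lambda>p q.
          form_times_d (A h0 \<omega>) (act p y * act q x)) (\<Delta> h1)) (\<Delta> h)"
        by (simp add: A_times_d act_flat
            clinear_tensor_lift_push[OF cbilinear_right[OF cbilinear_times_d]])
      also have "\<dots> = tensor_lift (\<lambda>h0 h1. tensor_lift (\<lambda>p q.
          form_times_d (A p \<omega>) (act q y * act h1 x)) (\<Delta> h0)) (\<Delta> h)"
        by (rule coassoc_lift[symmetric]) (intro lin)+
      finally show ?thesis .
    qed
    have 2: "A h (form_times_d (form_mult_right \<omega> y) x) =
        tensor_lift (\<lambda>h0 h1. tensor_lift (\<lambda>p q.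
          form_times_d (form_mult_right (A p \<omega>) (act q y)) (act h1 x)) (\<Delta> h0)) (\<Delta> h)"
      by (simp add: A_times_d IH' clinear_tensor_lift_push[OF cbilinear_left[OF cbilinear_times_d]])
    \<comment> \<open>Both summands now run over the same iterated coproduct, so the rule for
      (\<omega> dy) x can be reassembled term by term.\<close>
    have "A h (form_mult_right (form_times_d \<omega> y) x) =
        tensor_lift (\<lambda>h0 h1. tensor_lift (\<lambda>p q.
          form_times_d (A p \<omega>) (act q y * act h1 x)
          - form_times_d (form_mult_right (A p \<omega>) (act q y)) (act h1 x)) (\<Delta> h0)) (\<Delta> h)"
      by (simp only: form_mult_right_times_d clinear_diff[OF cbilinear_right[OF cbilinear_A]]
          1 2 tensor_lift_minus)
    also have "\<dots> = tensor_lift (\<lambda>h0 h1. form_mult_right (A h0 (form_times_d \<omega> y)) (act h1 x)) (\<Delta> h)"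
      by (simp only: form_mult_right_times_d[symmetric] A_times_d
          clinear_tensor_lift_push[OF cbilinear_left[OF cbilinear_mult_right]])
    finally show "?F i (form_times_d \<omega> y) = ?G i (form_times_d \<omega> y)" by (simp add: i)
  qed (intro lin)+
  from this[of "(h, x)"] show ?thesis by simp
qed

lemma A_d: "A h (form_d \<omega>) = form_d (A h \<omega>)"
proof (rule uforms_eq_induct[where F = "\<lambda>h \<omega>. A h (form_d \<omega>)" and G = "\<lambda>h \<omega>. form_d (A h \<omega>)"])
  fix h a
  \<comment> \<open>Since da is 1 da, the action also meets the unit in front, where h0 acts as the
    scalar \<epsilon>(h0).\<close>
  have "A h (form_d (form a [])) = A h (form_times_d (form 1 []) (algebra_part a))"
    by (simp add: form_d_form)
  also have "\<dots> = tensor_lift (\<lambda>h0 h1. \<epsilon> h0 *\<^sub>C form_times_d (form 1 []) (act h1 (algebra_part a))) (\<Delta> h)"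
  proof -
    have "unitization_act \<epsilon> act h0 1 = \<epsilon> h0 *\<^sub>C (1 :: 'r unitization)" for h0
      by (simp add: unitization_act_def one_unitization_def scaleC_unitization_def
          clinear_0[OF cbilinear_right[OF act_bilinear]])
    then show ?thesis
      by (simp add: A_times_d A_Nil clinear_scale[OF clinear_form_left[OF clinear_id]]
          clinear_scale[OF cbilinear_left[OF cbilinear_times_d]] del: form_times_d_form)
  qed
  also have "\<dots> = form_d (A h (form a []))"
    by (subst counit_left_lift, intro lin) (simp add: A_Nil form_d_form unitization_act_def)
  finally show "A h (form_d (form a [])) = form_d (A h (form a []))" .
next
  fix h x and \<omega> :: "'r uforms"
  assume "\<And>h. A h (form_d \<omega>) = form_d (A h \<omega>)"
  then show "A h (form_d (form_times_d \<omega> x)) = form_d (A h (form_times_d \<omega> x))"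
    by (simp add: form_d_times_d A_times_d clinear_tensor_lift_push[OF clinear_form_d])
qed (intro lin)+

text \<open>Keeps the sign in \<open>b\<close> and the number of summands of \<open>B\<close> the
  same for all terms of h \<omega>.\<close>

lemma A_degree:
  assumes "\<omega> \<in> uforms_degree n"
  shows "A h \<omega> \<in> uforms_degree n"
proof -
  have "A h (form a as) \<in> uforms_degree (length as)" for h a as
  proof (induction as arbitrary: h rule: rev_induct)
    case Nil
    show ?case using form_mem_uforms_degree[of _ "[]"] by (simp add: A_Nil)
  next
    case (snoc x xs)
    have "A h (form a (xs @ [x])) =
        tensor_lift (\<lambda>h0 h1. form_times_d (A h0 (form a xs)) (act h1 x)) (\<Delta> h)"
      by (subst A_times_d[symmetric]) simp
    also have "\<dots> \<in> uforms_degree (Suc (length xs))"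
      using form_times_d_mem_uforms_degree[OF snoc]
      unfolding uforms_degree_def by (intro tensor_lift_mem_span)
    finally show ?case by simp
  qed
  then show ?thesis
    unfolding uforms_degree_def
    by (intro clinear_mem_span[OF cbilinear_right[OF cbilinear_A] _ assms[unfolded uforms_degree_def]])
      auto
qed

end

section \<open>Integration by parts\<close>

locale twisted_hopf_action = hopf_action \<Delta> \<epsilon> S act
  for \<Delta> :: "'h::complex_algebra_1 \<Rightarrow> ('h, 'h) tensor" and \<epsilon> S
    and act :: "'h \<Rightarrow> 'r::complex_algebra \<Rightarrow> 'r" +
  fixes \<delta> :: "'h \<Rightarrow> complex"
  assumes delta_linear: "clinear \<delta>"
    and twisted_involutive: "twisted_antipode \<Delta> S \<delta> (twisted_antipode \<Delta> S \<delta> h) = h"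
begin

abbreviation "S\<^sub>\<delta> \<equiv> twisted_antipode \<Delta> S \<delta>"
abbreviation "K \<equiv> localization_kernel A \<delta> forms"

lemma generator_mem_K: "v \<in> forms \<Longrightarrow> A h v - \<delta> h *\<^sub>C v \<in> K"
  unfolding localization_kernel_def by (rule complex_vector.span_base) blast

lemma subspace_K: "complex_vector.subspace K"
  unfolding localization_kernel_def by (rule complex_vector.subspace_span)

lemma tensor_lift_mem_K: "(\<And>x y. f x y \<in> K) \<Longrightarrow> tensor_lift f t \<in> K"
  unfolding localization_kernel_def by (rule tensor_lift_mem_span)

lemma integration_by_parts: "form_mult_left (act h x) \<omega> - form_mult_left x (A (S\<^sub>\<delta> h) \<omega>) \<in> K"
proof -
  \<comment> \<open>After h0 is distributed over the product and the legs are regrouped, the last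
    two meet as \<open>p * S q\<close> and collapse to the counit, leaving h(x) \<omega>.\<close>
  have "tensor_lift (\<lambda>h0 h1. A h0 (form_mult_left x (A (S h1) \<omega>))) (\<Delta> h) =
      tensor_lift (\<lambda>h0 h1. tensor_lift (\<lambda>p q. form_mult_left (act p x) (A (q * S h1) \<omega>)) (\<Delta> h0)) (\<Delta> h)"
    by (simp add: A_mult_left A_mult)
  also have "\<dots> = tensor_lift (\<lambda>h0 h1. tensor_lift (\<lambda>p q.
      form_mult_left (act h0 x) (A (p * S q) \<omega>)) (\<Delta> h1)) (\<Delta> h)"
    by (rule coassoc_lift) (intro lin)+
  also have "\<dots> = tensor_lift (\<lambda>h0 h1. form_mult_left (act h0 x)
      (A (tensor_lift (\<lambda>p q. p * S q) (\<Delta> h1)) \<omega>)) (\<Delta> h)"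
    by (simp add: clinear_tensor_lift_push[OF cbilinear_right[OF cbilinear_mult_left]]
        clinear_tensor_lift_push[OF cbilinear_left[OF cbilinear_A]])
  also have "\<dots> = tensor_lift (\<lambda>h0 h1. \<epsilon> h1 *\<^sub>C form_mult_left (act h0 x) \<omega>) (\<Delta> h)"
    by (simp add: antipode_right clinear_scale[OF cbilinear_left[OF cbilinear_A]] A_one
        clinear_scale[OF cbilinear_right[OF cbilinear_mult_left]])
  also have "\<dots> = form_mult_left (act h x) \<omega>"
    by (rule counit_right_lift) (intro lin)
  finally have 1: "form_mult_left (act h x) \<omega> =
      tensor_lift (\<lambda>h0 h1. A h0 (form_mult_left x (A (S h1) \<omega>))) (\<Delta> h)" ..
  have 2: "form_mult_left x (A (S\<^sub>\<delta> h) \<omega>) =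
      tensor_lift (\<lambda>h0 h1. \<delta> h0 *\<^sub>C form_mult_left x (A (S h1) \<omega>)) (\<Delta> h)"
    unfolding twisted_antipode_def
    by (simp add: clinear_tensor_lift_push[OF cbilinear_right[OF cbilinear_mult_left]]
        clinear_tensor_lift_push[OF cbilinear_left[OF cbilinear_A]]
        clinear_scale[OF cbilinear_left[OF cbilinear_A]]
        clinear_scale[OF cbilinear_right[OF cbilinear_mult_left]])
  \<comment> \<open>Term by term the difference is a generator of \<open>K\<close>: h0 minus
    \<delta>(h0), applied to x S(h1)\<omega>.\<close>
  show ?thesis
    unfolding 1 2 tensor_lift_minus[symmetric]
    by (intro tensor_lift_mem_K generator_mem_K form_mult_left_forms)
qed

text \<open>In \<omega> dx the action gives h0 to \<omega> and h1 to x, while the commutator term x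
  \<omega> has x in front. The legs thus come in the order opposite to that of
  \<open>A_mult_left\<close>.\<close>

lemma flipped_action_mem_K:
  "tensor_lift (\<lambda>h0 h1. form_mult_left (act h1 x) (A h0 \<omega>)) (\<Delta> h) - \<delta> h *\<^sub>C form_mult_left x \<omega> \<in> K"
proof -
  \<comment> \<open>Integration by parts with \<open>S\<^sub>\<delta> h0\<close> as acting element
    and \<open>act h1 x\<close> as algebra element.\<close>
  have "tensor_lift (\<lambda>h0 h1. form_mult_left (act (S\<^sub>\<delta> h0) (act h1 x)) \<omega>
      - form_mult_left (act h1 x) (A (S\<^sub>\<delta> (S\<^sub>\<delta> h0)) \<omega>)) (\<Delta> h) \<in> K"
    by (intro tensor_lift_mem_K integration_by_parts)
  moreover have "tensor_lift (\<lambda>h0 h1. form_mult_left (act (S\<^sub>\<delta> h0) (act h1 x)) \<omega>) (\<Delta> h) =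
      form_mult_left (act (tensor_lift (\<lambda>h0 h1. S\<^sub>\<delta> h0 * h1) (\<Delta> h)) x) \<omega>"
    by (simp add: act_mult clinear_tensor_lift_push[OF cbilinear_left[OF act_bilinear]]
        clinear_tensor_lift_push[OF cbilinear_left[OF cbilinear_mult_left]])
  ultimately have "\<delta> h *\<^sub>C form_mult_left x \<omega> -
      tensor_lift (\<lambda>h0 h1. form_mult_left (act h1 x) (A h0 \<omega>)) (\<Delta> h) \<in> K"
    by (simp add: tensor_lift_minus twisted_involutive twisted_antipode_convolution[OF delta_linear]
        act_scale_left act_one clinear_scale[OF cbilinear_left[OF cbilinear_mult_left]])
  from complex_vector.subspace_neg[OF subspace_K this] show ?thesis by simp
qed

section \<open>Stability of the localization kernel under the operators\<close>

lemma d_kernel: "v \<in> K \<Longrightarrow> form_d v \<in> K"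
  by (erule localization_kernel_closed[OF clinear_form_d, rotated])
    (simp add: clinear_diff[OF clinear_form_d] clinear_scale[OF clinear_form_d]
      A_d[symmetric] generator_mem_K form_d_forms)

text \<open>Up to sign, \<open>b\<close> turns the generator for \<omega> dx into the generator for
  \<omega> x minus the flipped expression for x \<omega>. The generator appears because right
  multiplication by x keeps the order of the legs.\<close>

lemma b_kernel_times_d:
  assumes "\<omega> \<in> uforms_degree n"
  shows "form_b (A h (form_times_d \<omega> x) - \<delta> h *\<^sub>C form_times_d \<omega> x) \<in> K"
proof -
  let ?r = "A h (form_mult_right \<omega> x) - \<delta> h *\<^sub>C form_mult_right \<omega> x"
  let ?l = "tensor_lift (\<lambda>h0 h1. form_mult_left (act h1 x) (A h0 \<omega>)) (\<Delta> h)
      - \<delta> h *\<^sub>C form_mult_left x \<omega>"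
  have "form_b (A h (form_times_d \<omega> x)) = (-1) ^ n *\<^sub>C (A h (form_mult_right \<omega> x)
      - tensor_lift (\<lambda>h0 h1. form_mult_left (act h1 x) (A h0 \<omega>)) (\<Delta> h))"
    by (simp add: A_times_d clinear_tensor_lift_push[OF clinear_form_b]
        form_b_times_d[OF A_degree[OF assms]] clinear_tensor_lift_push[OF clinear_scaleC, symmetric]
        tensor_lift_minus A_mult_right)
  then have "form_b (A h (form_times_d \<omega> x) - \<delta> h *\<^sub>C form_times_d \<omega> x) = (-1) ^ n *\<^sub>C (?r - ?l)"
    by (simp add: clinear_diff[OF clinear_form_b] clinear_scale[OF clinear_form_b]
        form_b_times_d[OF assms] complex_vector.scale_right_diff_distrib scaleC_scaleC mult.commute)
  also have "\<dots> \<in> K"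
    by (intro complex_vector.subspace_scale complex_vector.subspace_diff subspace_K
        generator_mem_K form_mult_right_forms flipped_action_mem_K)
  finally show ?thesis .
qed

text \<open>For fixed h the requirement on \<open>v\<close> is linear, so it cuts out a subspace
  \<open>W\<close>; it suffices that \<open>W\<close> contains the spanning set of
  \<open>forms_eq_span\<close>.\<close>

lemma operator_kernel:
  assumes T: "clinear T"
    and Nil: "\<And>h a. T (A h (form (unitization_of a) []) - \<delta> h *\<^sub>C form (unitization_of a) []) \<in> K"
    and snoc: "\<And>h a as x. T (A h (form a (as @ [x])) - \<delta> h *\<^sub>C form a (as @ [x])) \<in> K"
    and "v \<in> K"
  shows "T v \<in> K"
proof (rule localization_kernel_closed[OF T _ \<open>v \<in> K\<close>])
  fix h and v :: "'r uforms"
  define f where "f = (\<lambda>v. T (A h v - \<delta> h *\<^sub>C v))"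
  have "clinear f"
    unfolding f_def by (rule clinear_compose[OF T]) (intro lin)
  then interpret f: Vector_Spaces.linear scaleC scaleC f .
  define W where "W = {v. f v \<in> K}"
  have W: "complex_vector.subspace W"
    unfolding W_def by (rule f.subspace_linear_preimage[OF subspace_K])
  have "forms \<subseteq> W"
    unfolding forms_eq_span
    by (rule complex_vector.span_minimal[OF _ W]) (use Nil snoc in \<open>auto simp: W_def f_def\<close>)
  moreover assume "v \<in> forms"
  ultimately show "T (A h v - \<delta> h *\<^sub>C v) \<in> K" by (auto simp: W_def f_def)
qed

lemma b_kernel: "v \<in> K \<Longrightarrow> form_b v \<in> K"
proof (rule operator_kernel[OF clinear_form_b])
  \<comment> \<open>The action preserves degree 0, where \<open>b\<close> vanishes.\<close>
  show "form_b (A h (form (unitization_of a) []) - \<delta> h *\<^sub>C form (unitization_of a) []) \<in> K" for h a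
    by (simp add: A_Nil clinear_diff[OF clinear_form_b] clinear_scale[OF clinear_form_b]
        form_b_form_Nil complex_vector.subspace_0[OF subspace_K])
  show "form_b (A h (form a (as @ [x])) - \<delta> h *\<^sub>C form a (as @ [x])) \<in> K" for h a as x
    using b_kernel_times_d[OF form_mem_uforms_degree, of h a as x] by simp
qed

lemma k_kernel: "v \<in> K \<Longrightarrow> form_k v \<in> K"
  unfolding form_k_def
  by (intro complex_vector.subspace_diff complex_vector.subspace_add subspace_K b_kernel d_kernel)

lemma B_degree_kernel: "v \<in> K \<Longrightarrow> form_B_degree n v \<in> K"
proof -
  assume "v \<in> K"
  then have "(form_k ^^ i) (form_d v) \<in> K" for i
    by (induction i) (simp_all add: d_kernel k_kernel)
  then show ?thesis
    unfolding form_B_degree_def by (intro complex_vector.subspace_sum[OF subspace_K])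
qed

lemma B_kernel: "v \<in> K \<Longrightarrow> form_B v \<in> K"
proof (rule operator_kernel[OF clinear_form_B])
  \<comment> \<open>A generator built from one symbol is homogeneous, so there \<open>B\<close>
    agrees with \<open>form_B_degree (length as)\<close>, which preserves \<open>K\<close> because
    \<open>d\<close> and \<open>k\<close> do.\<close>
  have *: "form_B (A h (form a as) - \<delta> h *\<^sub>C form a as) \<in> K" if "form a as \<in> forms" for h a as
  proof -
    have "A h (form a as) - \<delta> h *\<^sub>C form a as \<in> uforms_degree (length as)"
      using A_degree[OF form_mem_uforms_degree[of a as], of h] form_mem_uforms_degree[of a as]
      unfolding uforms_degree_def
      by (intro complex_vector.span_diff complex_vector.span_scale)
    from form_B_eq_degree[OF this] show ?thesis
      by (simp add: B_degree_kernel generator_mem_K that)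
  qed
  show "form_B (A h (form (unitization_of a) []) - \<delta> h *\<^sub>C form (unitization_of a) []) \<in> K" for h a
    by (rule *) (rule forms_form_Nil)
  show "form_B (A h (form a (as @ [x])) - \<delta> h *\<^sub>C form a (as @ [x])) \<in> K" for h a as x
    by (rule *) (simp add: forms_form)
qed

end

theorem proposition2p5:
  fixes \<Delta> :: "'h::complex_algebra_1 \<Rightarrow> ('h, 'h) tensor"
    and \<epsilon> :: "'h \<Rightarrow> complex"
    and S :: "'h \<Rightarrow> 'h"
    and \<delta> :: "'h \<Rightarrow> complex"
    and act :: "'h \<Rightarrow> 'r::complex_algebra \<Rightarrow> 'r"
  assumes "hopf_algebra \<Delta> \<epsilon> S"
    and "character \<delta>"
    and "twisted_antipode \<Delta> S \<delta> \<circ> twisted_antipode \<Delta> S \<delta> = id"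
    and "H_algebra act \<Delta>"
  shows "descends_to_localization (form_act \<Delta> \<epsilon> act) \<delta> forms form_d \<and>
    descends_to_localization (form_act \<Delta> \<epsilon> act) \<delta> forms form_b \<and>
    descends_to_localization (form_act \<Delta> \<epsilon> act) \<delta> forms form_k \<and>
    descends_to_localization (form_act \<Delta> \<epsilon> act) \<delta> forms form_B"
proof -
  interpret twisted_hopf_action \<Delta> \<epsilon> S act \<delta>
  proof (intro twisted_hopf_action.intro hopf_action.intro twisted_hopf_action_axioms.intro)
    show "clinear \<delta>" using assms(2) by (simp add: character_def)
    show "twisted_antipode \<Delta> S \<delta> (twisted_antipode \<Delta> S \<delta> h) = h" for h
      using fun_cong[OF assms(3), of h] by simp
  qed (fact assms)+
  show ?thesis
    using descends_to_localizationI[OF clinear_form_d form_d_forms d_kernel]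
      descends_to_localizationI[OF clinear_form_b form_b_forms b_kernel]
      descends_to_localizationI[OF clinear_form_k form_k_forms k_kernel]
      descends_to_localizationI[OF clinear_form_B form_B_forms B_kernel]
    by blast
qed

end
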